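(* Assume (H) and that $\mu_0$ is supported in $\{x\in\mathbb R^d:\|x\|_2\le K\}$. Let $\eta_0^1,\dots,\eta_0^N$ be i.i.d. with law $\mu_0$, $\mu_0^N:=\frac1N\sum_{j=1}^N\delta_{\eta_0^j}$, and $Y_0\sim N(0,\mathbb I_d)$ independent of $(\eta_0^j)_j$. Let $Y_t$ solve $\dot Y_t=b^{\mu_0}_t(Y_t)$, $Y_t|_{t=0}=Y_0$, and let $Y^N_t$ solve $$\frac{dY^N_t}{dt}=\frac{\sigma_t'}{\sigma_t}\big[Y^N_t-\mathcal D^{\mu_0^N}_t(Y^N_t)\big],\qquad Y^N_t|_{t=0}=Y_0.$$ Then for all $t\in[0,T)$, $$\sup_{N\in\mathbb N}\Big(\sqrt N\,\mathbb E\|Y_t-Y^N_t\|_2\Big)\le2K\beta_t\,e^{K^2\beta_t^2/(2\sigma_t^2)},$$ where the expectation is over $(\eta_0^j)_j$ and $Y_0$.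
   Context: Fix $d\in\mathbb N$, $T\in(0,\infty]$. Assumption (H): $\sigma:[0,T)\to(0,\infty)$ is continuous, strictly decreasing and differentiable with derivative $\sigma'_t$ bounded on $[0,t_0]$ for every $t_0<T$, $\sigma_0=1$, $\lim_{t\uparrow T}\sigma_t=0$; and $\beta_t:=1-\sigma_t$. For $\sigma>0$, $\rho_\sigma(x):=(2\pi\sigma^2)^{-d/2}e^{-\|x\|_2^2/(2\sigma^2)}$. For a probability measure $\nu$, $\mathcal D^{\nu}_t(x):=\int y\rho_{\sigma_t}(x-\beta_ty)\nu(dy)/\int\rho_{\sigma_t}(x-\beta_ty)\nu(dy)$, and $b^{\mu_0}_t(x):=\frac{\sigma'_t}{\sigma_t}(x-\mathcal D^{\mu_0}_t(x))$. *)

theory Defs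
  imports "HOL-Probability.Probability"
begin

definition tdom :: "ereal \<Rightarrow> real set" where
  "tdom T = {t. 0 \<le> t \<and> ereal t < T}"

definition rho :: "real \<Rightarrow> 'a::euclidean_space \<Rightarrow> real" where
  "rho s x = (2 * pi * s\<^sup>2) powr (- real DIM('a) / 2) * exp (- (norm x)\<^sup>2 / (2 * s\<^sup>2))"

text \<open>Denoiser D^nu_t(x), with beta_t = 1 - sigma_t.\<close>
definition denoiser :: "(real \<Rightarrow> real) \<Rightarrow> 'a::euclidean_space measure \<Rightarrow> real \<Rightarrow> 'a \<Rightarrow> 'a" where
  "denoiser \<sigma> \<nu> t x =
     (\<integral> y. rho (\<sigma> t) (x - (1 - \<sigma> t) *\<^sub>R y) *\<^sub>R y \<partial>\<nu>) /\<^sub>R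
     (\<integral> y. rho (\<sigma> t) (x - (1 - \<sigma> t) *\<^sub>R y) \<partial>\<nu>)"

definition drift :: "(real \<Rightarrow> real) \<Rightarrow> (real \<Rightarrow> real) \<Rightarrow> 'a::euclidean_space measure \<Rightarrow> real \<Rightarrow> 'a \<Rightarrow> 'a" where
  "drift \<sigma> \<sigma>' \<nu> t x = (\<sigma>' t / \<sigma> t) *\<^sub>R (x - denoiser \<sigma> \<nu> t x)"

text \<open>Empirical measure (1/N) sum_{j<N} delta_{x_j} (with multiplicities), for N >= 1.\<close>
definition emp_measure :: "(nat \<Rightarrow> 'a) \<Rightarrow> nat \<Rightarrow> 'a measure" where
  "emp_measure x N = measure_pmf (pmf_of_multiset (image_mset x (mset_set {..<N})))"

end

theory Submission
  imports Defs
begin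

text \<open>
  With \<open>X = Y / \<sigma>\<close> and the clock \<open>\<tau> = (1 - \<sigma>) / \<sigma>\<close> the flow becomes \<open>dX / d\<tau> = m\<^sub>\<tau>(X)\<close>, where
  \<open>m\<^sub>s(x)\<close> is the mean of \<open>\<mu>0\<close> tilted by \<open>w\<^sub>s(x,y) = exp (s x\<bullet>y - s\<^sup>2|y|\<^sup>2 / 2)\<close>; it is
  \<open>sK\<^sup>2\<close>-Lipschitz in \<open>x\<close>, being the gradient of a log-Laplace transform with covariance at most \<open>K\<^sup>2\<close>.
  Gronwall thus bounds the distance of the two flows by
  \<open>\<integral> exp (K\<^sup>2(\<tau>\<^sup>2 - s\<^sup>2) / 2) |m\<^sub>s(X\<^sub>s) - m\<^sub>s\<^sup>N(X\<^sub>s)| ds\<close>.  The law of \<open>X\<^sub>s\<close> has density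
  \<open>\<phi>(x) E[w\<^sub>s(x,\<eta>)]\<close>, \<open>\<phi>\<close> the standard Gaussian density, so that the Monte Carlo error of the
  ratio \<open>m\<^sub>s\<^sup>N\<close> averages to at most \<open>2K exp (K\<^sup>2s\<^sup>2 / 2) / sqrt N\<close>.

  The law of \<open>X\<^sub>s\<close> enters without the continuity equation or a flow map, because all estimates are
  made for Euler steps \<open>x \<mapsto> x + h m\<^sub>s(x)\<close>.  If \<open>m\<^sub>s(x)\<close> is replaced by a sample from the tilted measure,
  the chain has exactly the law \<open>s\<eta> + Z\<close>, and it stays within \<open>O(h)\<close> of the Euler scheme in mean square.
\<close>

section \<open>Gaussian tilts of a bounded law\<close>

text \<open>Two choices produce the constant. In the Gronwall estimate the Lipschitz bound is the
  one of the empirical field, and the defect is read along the exact flow. That flow is a function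
  of \<open>Y0\<close> alone, hence independent of the sample, so the error at a point can be
  averaged over the sample and over \<open>Y0\<close> separately. The second obstacle is the random
  denominator of the ratio m_s^N, which may be small. Multiplied by the mass E[w_s(x,\<eta>)], the
  error m_s^N - m_s becomes the error of the numerator minus m_s^N times the error of the
  denominator, and |m_s^N| <= K. This mass is exactly the density of X_s relative to the Gaussian,
  so the average over X_s supplies it for free. Numerator and denominator contribute equally, whence
  the 2 in 2K; the exponential comes from w_s^2 = exp(s^2 |y|^2) w_{2s}, whose Gaussian average is
  at most exp(s^2 K^2). The product of the Gronwall factor and the Monte Carlo factor does not
  depend on s. Integration over the clock therefore just multiplies by \<tau>, and returning from X
  to Y multiplies by \<sigma>, with \<sigma> \<tau> = 1 - \<sigma>.\<close>

definition tilt_weight :: "real \<Rightarrow> 'a::euclidean_space \<Rightarrow> 'a \<Rightarrow> real" where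
  "tilt_weight s x y = exp (s * (x \<bullet> y) - s\<^sup>2 * (norm y)\<^sup>2 / 2)"

definition tilt_mass :: "'a::euclidean_space measure \<Rightarrow> real \<Rightarrow> 'a \<Rightarrow> real" where
  "tilt_mass \<nu> s x = (\<integral>y. tilt_weight s x y \<partial>\<nu>)"

definition tilt_mean :: "'a::euclidean_space measure \<Rightarrow> real \<Rightarrow> 'a \<Rightarrow> 'a" where
  "tilt_mean \<nu> s x = (\<integral>y. tilt_weight s x y *\<^sub>R y \<partial>\<nu>) /\<^sub>R tilt_mass \<nu> s x"

definition tilted :: "'a::euclidean_space measure \<Rightarrow> real \<Rightarrow> 'a \<Rightarrow> 'a measure" where
  "tilted \<nu> s x = density \<nu> (\<lambda>y. ennreal (tilt_weight s x y / tilt_mass \<nu> s x))"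

lemma tilt_weight_pos [simp]: "0 < tilt_weight s x y"
  by (simp add: tilt_weight_def)

lemma tilt_weight_nonneg [simp]: "0 \<le> tilt_weight s x y"
  by (simp add: tilt_weight_def)

lemma tilt_weight_measurable [measurable]:
  assumes [measurable]: "f \<in> borel_measurable M" "g \<in> borel_measurable M"
  shows "(\<lambda>w. tilt_weight s (f w) (g w)) \<in> borel_measurable M"
  unfolding tilt_weight_def by measurable

text \<open>A shift of the base point leaves the quadratic part alone and contributes an exponential
  that is linear in the exponent, so dependence on \<open>x\<close> reduces to exponential tilts of
  an already tilted law.\<close>

lemma tilt_weight_add: "tilt_weight s (x + d) y = exp ((s *\<^sub>R d) \<bullet> y) * tilt_weight s x y"
  by (simp add: tilt_weight_def exp_add[symmetric] inner_left_distrib algebra_simps)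

lemma tilt_weight_le:
  assumes "norm y \<le> K"
  shows "tilt_weight s x y \<le> exp (\<bar>s\<bar> * norm x * K)"
proof -
  have "s * (x \<bullet> y) \<le> \<bar>s\<bar> * \<bar>x \<bullet> y\<bar>" by (metis abs_ge_self abs_mult)
  also have "\<dots> \<le> \<bar>s\<bar> * (norm x * norm y)"
    by (intro mult_left_mono Cauchy_Schwarz_ineq2) auto
  also have "\<dots> \<le> \<bar>s\<bar> * (norm x * K)"
    using assms by (intro mult_left_mono) auto
  finally have "s * (x \<bullet> y) \<le> \<bar>s\<bar> * norm x * K" by (simp add: mult.assoc)
  moreover have "0 \<le> s\<^sup>2 * (norm y)\<^sup>2 / 2" by simp
  ultimately show ?thesis unfolding tilt_weight_def by (subst exp_le_cancel_iff) linarith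
qed

text \<open>Expanding the square leaves \<open>rho r x\<close> as the only factor besides the
  weight. It is free of \<open>y\<close> and cancels in the quotient defining the denoiser; the
  clock and the rescaled point are read off here.\<close>

lemma rho_eq_tilt_weight:
  fixes x y :: "'a::euclidean_space"
  assumes "0 < r"
  shows "rho r (x - (1 - r) *\<^sub>R y) = rho r x * tilt_weight ((1 - r) / r) (x /\<^sub>R r) y"
proof -
  define b where "b = 1 - r"
  have n: "(norm (x - b *\<^sub>R y))\<^sup>2 = (norm x)\<^sup>2 - 2 * b * (x \<bullet> y) + b\<^sup>2 * (norm y)\<^sup>2"
    unfolding power2_norm_eq_inner
    by (simp add: inner_diff_left inner_diff_right inner_commute power2_eq_square algebra_simps)
  have "- (norm (x - b *\<^sub>R y))\<^sup>2 / (2 * r\<^sup>2)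
      = - (norm x)\<^sup>2 / (2 * r\<^sup>2) + (b / r * ((x /\<^sub>R r) \<bullet> y) - (b / r)\<^sup>2 * (norm y)\<^sup>2 / 2)"
    unfolding n inner_scaleR_left using assms
    by (simp add: field_simps power2_eq_square)
  then show ?thesis unfolding b_def[symmetric] by (simp add: rho_def tilt_weight_def exp_add[symmetric])
qed

lemma rho_pos: "0 < r \<Longrightarrow> 0 < rho r x"
  by (simp add: rho_def)

lemma denoiser_eq_tilt_mean:
  assumes "0 < \<sigma> t"
  shows "denoiser \<sigma> \<nu> t x = tilt_mean \<nu> ((1 - \<sigma> t) / \<sigma> t) (x /\<^sub>R \<sigma> t)"
  using rho_pos[OF assms, of x]
  by (simp add: denoiser_def tilt_mean_def tilt_mass_def rho_eq_tilt_weight[OF assms] mult.commute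
      flip: scaleR_scaleR) (simp add: mult.commute)

text \<open>Carriers other than the Borel sets are allowed because \<^const>\<open>emp_measure\<close> is discrete.\<close>
locale bounded_law = prob_space \<nu> for \<nu> :: "'a::euclidean_space measure" +
  fixes K :: real
  assumes ident_measurable [measurable]: "(\<lambda>y. y) \<in> borel_measurable \<nu>"
    and AE_norm_le: "AE y in \<nu>. norm y \<le> K"
begin

lemma K_nonneg: "0 \<le> K"
proof -
  have "AE y in \<nu>. 0 \<le> K"
    using AE_norm_le by eventually_elim (meson norm_ge_zero order_trans)
  then show ?thesis by simp
qed

lemma integrable_if_bounded:
  fixes f :: "'a \<Rightarrow> 'b::{banach, second_countable_topology}"
  assumes "f \<in> borel_measurable borel" "\<And>y. norm y \<le> K \<Longrightarrow> norm (f y) \<le> B"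
  shows "integrable \<nu> f"
proof (rule integrable_const_bound[of _ B])
  show "AE y in \<nu>. norm (f y) \<le> B"
    using AE_norm_le by eventually_elim (use assms in auto)
  show "f \<in> borel_measurable \<nu>"
    using measurable_compose[OF ident_measurable assms(1)] by simp
qed

lemma integrable_tilt_weight: "integrable \<nu> (tilt_weight s x)"
  by (rule integrable_if_bounded[of _ "exp (\<bar>s\<bar> * norm x * K)"]) (auto intro: tilt_weight_le)

lemma tilt_mass_pos: "0 < tilt_mass \<nu> s x"
  unfolding tilt_mass_def using integrable_tilt_weight[of s x]
  by (subst less_le) (auto simp: integral_nonneg_eq_0_iff_AE integral_nonneg_AE less_imp_neq[OF tilt_weight_pos, symmetric] )

lemma integral_tilted:
  fixes f :: "'a \<Rightarrow> 'b::{banach, second_countable_topology}"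
  assumes [measurable]: "f \<in> borel_measurable \<nu>"
  shows "(\<integral>y. f y \<partial>tilted \<nu> s x) = (\<integral>y. tilt_weight s x y *\<^sub>R f y \<partial>\<nu>) /\<^sub>R tilt_mass \<nu> s x"
  using tilt_mass_pos[of s x] unfolding tilted_def
  by (subst integral_density)
     (auto simp: divide_inverse_commute scaleR_scaleR[symmetric] less_imp_le simp del: scaleR_scaleR)

lemma tilt_mean_eq_tilted: "tilt_mean \<nu> s x = (\<integral>y. y \<partial>tilted \<nu> s x)"
  by (simp add: integral_tilted tilt_mean_def)

lemma nn_integral_tilted:
  assumes [measurable]: "f \<in> borel_measurable \<nu>"
  shows "(\<integral>\<^sup>+y. f y \<partial>tilted \<nu> s x) = (\<integral>\<^sup>+y. ennreal (tilt_weight s x y / tilt_mass \<nu> s x) * f y \<partial>\<nu>)"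
  unfolding tilted_def by (subst nn_integral_density) auto

text \<open>Tilting stays within the locale with the same \<open>K\<close>, so every moment bound
  proved for \<open>\<nu>\<close> is available for all tilted laws.\<close>

lemma bounded_law_tilted: "bounded_law (tilted \<nu> s x) K"
proof -
  have "emeasure (tilted \<nu> s x) (space (tilted \<nu> s x)) = (\<integral>\<^sup>+y. ennreal (tilt_weight s x y / tilt_mass \<nu> s x) \<partial>\<nu>)"
    using nn_integral_tilted[of "\<lambda>_. 1" s x] by simp
  also have "\<dots> = ennreal (\<integral>y. tilt_weight s x y / tilt_mass \<nu> s x \<partial>\<nu>)"
    using integrable_tilt_weight[of s x] tilt_mass_pos[of s x]
    by (intro nn_integral_eq_integral) (auto simp: less_imp_le)
  also have "\<dots> = 1" using tilt_mass_pos[of s x] by (simp add: tilt_mass_def)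
  finally have "prob_space (tilted \<nu> s x)" by (rule prob_spaceI)
  moreover have "AE y in tilted \<nu> s x. norm y \<le> K"
    unfolding tilted_def using AE_norm_le by (subst AE_density) auto
  ultimately show ?thesis
    by (simp add: bounded_law_def bounded_law_axioms_def) (simp add: tilted_def)
qed

lemma integral_norm_sq_le: "(\<integral>y. (norm y)\<^sup>2 \<partial>\<nu>) \<le> K\<^sup>2"
proof -
  have "(\<integral>y. (norm y)\<^sup>2 \<partial>\<nu>) \<le> (\<integral>y. K\<^sup>2 \<partial>\<nu>)"
  proof (rule integral_mono_AE)
    show "integrable \<nu> (\<lambda>y. (norm y)\<^sup>2)"
      by (rule integrable_if_bounded[of _ "K\<^sup>2"]) (auto intro: power_mono)
    show "AE y in \<nu>. (norm y)\<^sup>2 \<le> K\<^sup>2"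
      using AE_norm_le by eventually_elim (auto intro: power_mono)
  qed auto
  then show ?thesis by (simp add: prob_space)
qed

lemma integrable_ident: "integrable \<nu> (\<lambda>y. y)"
  by (rule integrable_if_bounded[of _ K]) auto

lemma integrable_norm_diff_sq: "integrable \<nu> (\<lambda>y. (norm (y - a))\<^sup>2)"
  by (rule integrable_if_bounded[of _ "(K + norm a)\<^sup>2"])
     (auto intro!: power_mono order_trans[OF norm_triangle_ineq4])

text \<open>Bias-variance decomposition about an arbitrary centre. With the mean as \<open>a\<close>
  it bounds the variance; with general \<open>a\<close> it splits the squared error of a randomised
  step.\<close>

lemma integral_norm_diff_sq:
  "(\<integral>y. (norm (y - a))\<^sup>2 \<partial>\<nu>) =
     (norm ((\<integral>y. y \<partial>\<nu>) - a))\<^sup>2 + ((\<integral>y. (norm y)\<^sup>2 \<partial>\<nu>) - (norm (\<integral>y. y \<partial>\<nu>))\<^sup>2)"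
proof -
  have *: "(norm (y - b))\<^sup>2 = (norm y)\<^sup>2 - 2 * (y \<bullet> b) + (norm b)\<^sup>2" for y b :: 'a
    unfolding power2_norm_eq_inner by (simp add: inner_diff_left inner_diff_right inner_commute)
  have i: "integrable \<nu> (\<lambda>y. (norm y)\<^sup>2)"
    using integrable_norm_diff_sq[of 0] by simp
  show ?thesis unfolding * using integrable_ident i
    by (simp add: prob_space)
qed

lemma variance_le: "(\<integral>y. (norm (y - (\<integral>y. y \<partial>\<nu>)))\<^sup>2 \<partial>\<nu>) \<le> K\<^sup>2"
  using integral_norm_sq_le integral_norm_diff_sq[of "\<integral>y. y \<partial>\<nu>"]
    zero_le_power2[of "norm (\<integral>y. y \<partial>\<nu>)"]
  unfolding diff_self norm_zero power_zero_numeral by linarith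

lemma norm_integral_le: "norm (\<integral>y. y \<partial>\<nu>) \<le> K"
proof -
  have "norm (\<integral>y. y \<partial>\<nu>) \<le> (\<integral>y. norm y \<partial>\<nu>)" by (rule integral_norm_bound)
  also have "\<dots> \<le> (\<integral>y. K \<partial>\<nu>)"
    using AE_norm_le integrable_ident by (intro integral_mono_AE) auto
  finally show ?thesis by (simp add: prob_space)
qed

text \<open>After centring, the numerator is E[(exp(v.y) - 1)(y - m)], which is of first order in
  \<open>v\<close>. The factor \<open>exp (2 * K * norm v)\<close> may be crude because subdivision
  removes it later: half of the exponent bounds \<open>exp (v \<bullet> y) - 1\<close>, half bounds
  the normaliser from below.\<close>

lemma exp_tilt_diff_le:
  "norm ((\<integral>y. exp (v \<bullet> y) *\<^sub>R y \<partial>\<nu>) /\<^sub>R (\<integral>y. exp (v \<bullet> y) \<partial>\<nu>) - (\<integral>y. y \<partial>\<nu>))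
     \<le> K\<^sup>2 * norm v * exp (2 * K * norm v)"
proof -
  define m where "m = (\<integral>y. y \<partial>\<nu>)"
  define Z where "Z = (\<integral>y. exp (v \<bullet> y) \<partial>\<nu>)"
  have vy: "\<bar>v \<bullet> y\<bar> \<le> K * norm v" if "norm y \<le> K" for y
    using Cauchy_Schwarz_ineq2[of v y] mult_left_mono[OF that norm_ge_zero[of v]] by (simp add: mult.commute)
  have i1: "integrable \<nu> (\<lambda>y. exp (v \<bullet> y))"
    by (rule integrable_if_bounded[of _ "exp (K * norm v)"]) (auto dest: vy)
  have i2: "integrable \<nu> (\<lambda>y. exp (v \<bullet> y) *\<^sub>R y)"
    by (rule integrable_if_bounded[of _ "exp (K * norm v) * K"]) (auto dest: vy intro!: mult_mono)
  have "(\<integral>y. exp (- (K * norm v)) \<partial>\<nu>) \<le> Z"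
    unfolding Z_def using AE_norm_le i1 by (intro integral_mono_AE) (auto dest!: vy simp: abs_le_iff)
  then have Z: "exp (- (K * norm v)) \<le> Z" by (simp add: prob_space)
  then have Z0: "0 < Z" by (meson exp_gt_zero less_le_trans)
  have i3: "integrable \<nu> (\<lambda>y. (norm (y - m))\<^sup>2 + (norm y)\<^sup>2)"
    using integrable_norm_diff_sq[of m] integrable_norm_diff_sq[of 0] by simp
  \<comment> \<open>Inserting the -1 is free because \<open>y - m\<close> integrates to zero, and it
    yields the factor \<open>norm v\<close>.\<close>
  have eq: "(\<integral>y. (exp (v \<bullet> y) - 1) *\<^sub>R (y - m) \<partial>\<nu>) = (\<integral>y. exp (v \<bullet> y) *\<^sub>R y \<partial>\<nu>) - Z *\<^sub>R m"
    unfolding scaleR_diff_left scaleR_diff_right using i1 i2 integrable_ident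
    by (simp add: prob_space Z_def m_def)
  have b: "norm ((exp (v \<bullet> y) - 1) *\<^sub>R (y - m))
      \<le> exp (K * norm v) * norm v / 2 * ((norm (y - m))\<^sup>2 + (norm y)\<^sup>2)" if y: "norm y \<le> K" for y
  proof -
    have "\<bar>exp r - 1\<bar> \<le> exp \<bar>r\<bar> * \<bar>r\<bar>" for r :: real
    proof (cases "r \<ge> 0")
      case True
      have "(1 - r) * exp r \<le> exp (- r) * exp r"
        using exp_ge_add_one_self[of "- r"] by (intro mult_right_mono) auto
      then show ?thesis using True by (simp add: exp_minus algebra_simps)
    next
      case False
      have "1 - exp r \<le> - r" using exp_ge_add_one_self[of r] by linarith
      also have "\<dots> \<le> exp (- r) * (- r)" using False by simp
      finally have "1 - exp r \<le> exp (- r) * (- r)" .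
      moreover have "\<bar>exp r - 1\<bar> = 1 - exp r" "\<bar>r\<bar> = - r" using False by auto
      ultimately show ?thesis by (simp only:)
    qed
    from this[of "v \<bullet> y"] have "\<bar>exp (v \<bullet> y) - 1\<bar> \<le> exp \<bar>v \<bullet> y\<bar> * \<bar>v \<bullet> y\<bar>" .
    also have "\<dots> \<le> exp (K * norm v) * (norm v * norm y)"
      using vy[OF y] Cauchy_Schwarz_ineq2[of v y] by (intro mult_mono) auto
    finally have "norm ((exp (v \<bullet> y) - 1) *\<^sub>R (y - m))
        \<le> exp (K * norm v) * (norm v * norm y) * norm (y - m)"
      by (simp add: mult_right_mono)
    also have "\<dots> = exp (K * norm v) * norm v * (norm y * norm (y - m))" by (simp add: mult_ac)
    \<comment> \<open>Splitting into squares lets both second moments be bounded by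
      \<open>K\<^sup>2\<close>; the pointwise bound 2K on \<open>norm (y - m)\<close> would double
      the Lipschitz constant.\<close>
    also have "\<dots> \<le> exp (K * norm v) * norm v * (((norm (y - m))\<^sup>2 + (norm y)\<^sup>2) / 2)"
      using sum_squares_bound[of "norm y" "norm (y - m)"] by (intro mult_left_mono) auto
    finally show ?thesis by simp
  qed
  have "norm (\<integral>y. (exp (v \<bullet> y) - 1) *\<^sub>R (y - m) \<partial>\<nu>)
      \<le> (\<integral>y. exp (K * norm v) * norm v / 2 * ((norm (y - m))\<^sup>2 + (norm y)\<^sup>2) \<partial>\<nu>)"
  proof (rule order_trans[OF integral_norm_bound integral_mono_AE])
    show "integrable \<nu> (\<lambda>y. norm ((exp (v \<bullet> y) - 1) *\<^sub>R (y - m)))"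
      unfolding scaleR_diff_left scaleR_diff_right using i1 i2 integrable_ident by simp
    show "AE y in \<nu>. norm ((exp (v \<bullet> y) - 1) *\<^sub>R (y - m))
        \<le> exp (K * norm v) * norm v / 2 * ((norm (y - m))\<^sup>2 + (norm y)\<^sup>2)"
      using AE_norm_le by eventually_elim (rule b)
  qed (use i3 in simp)
  also have "\<dots> = exp (K * norm v) * norm v / 2 * ((\<integral>y. (norm (y - m))\<^sup>2 \<partial>\<nu>) + (\<integral>y. (norm y)\<^sup>2 \<partial>\<nu>))"
    using integrable_norm_diff_sq[of m] integrable_norm_diff_sq[of 0] by simp
  also have "\<dots> \<le> exp (K * norm v) * norm v / 2 * (K\<^sup>2 + K\<^sup>2)"
    using variance_le integral_norm_sq_le unfolding m_def[symmetric]
    by (intro mult_left_mono add_mono) auto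
  finally have 1: "norm ((\<integral>y. exp (v \<bullet> y) *\<^sub>R y \<partial>\<nu>) - Z *\<^sub>R m) \<le> K\<^sup>2 * norm v * exp (K * norm v)"
    unfolding eq by (simp add: algebra_simps)
  have "(\<integral>y. exp (v \<bullet> y) *\<^sub>R y \<partial>\<nu>) /\<^sub>R Z - m = ((\<integral>y. exp (v \<bullet> y) *\<^sub>R y \<partial>\<nu>) - Z *\<^sub>R m) /\<^sub>R Z"
    using Z0 by (simp add: scaleR_diff_right)
  then have "norm ((\<integral>y. exp (v \<bullet> y) *\<^sub>R y \<partial>\<nu>) /\<^sub>R Z - m)
      = norm ((\<integral>y. exp (v \<bullet> y) *\<^sub>R y \<partial>\<nu>) - Z *\<^sub>R m) * inverse Z"
    using Z0 by (simp add: mult.commute)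
  also have "\<dots> \<le> K\<^sup>2 * norm v * exp (K * norm v) * exp (K * norm v)"
  proof (rule mult_mono[OF 1])
    have "inverse Z \<le> inverse (exp (- (K * norm v)))" using Z by (intro le_imp_inverse_le) auto
    then show "inverse Z \<le> exp (K * norm v)" by (simp add: exp_minus)
  qed (use Z0 in auto)
  also have "\<dots> = K\<^sup>2 * norm v * exp (2 * K * norm v)"
    by (simp add: mult.assoc flip: exp_add)
  finally show ?thesis unfolding Z_def m_def .
qed

lemma norm_tilt_mean_le: "norm (tilt_mean \<nu> s x) \<le> K"
  unfolding tilt_mean_eq_tilted by (rule bounded_law.norm_integral_le[OF bounded_law_tilted])

end

text \<open>Subdividing the segment removes the factor \<open>exp (B |d|)\<close>, so the constant in the exponent of the
  final bound stays sharp without differentiating under the integral.\<close>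
lemma lipschitz_if_locally_lipschitz:
  fixes f :: "'a::real_normed_vector \<Rightarrow> 'b::real_normed_vector"
  assumes "\<And>x d. norm (f (x + d) - f x) \<le> C * norm d * exp (B * norm d)"
  shows "norm (f (x + d) - f x) \<le> C * norm d"
proof (rule LIMSEQ_le_const)
  have "(\<lambda>n. C * norm d * exp (B * norm d * inverse (real n))) \<longlonglongrightarrow> C * norm d * exp (B * norm d * 0)"
    by (intro tendsto_intros lim_inverse_n)
  then show "(\<lambda>n. C * norm d * exp (B * norm d * inverse (real n))) \<longlonglongrightarrow> C * norm d" by simp
  show "\<exists>N. \<forall>n\<ge>N. norm (f (x + d) - f x) \<le> C * norm d * exp (B * norm d * inverse (real n))"
  proof (intro exI allI impI)
    fix n :: nat assume n: "n \<ge> 1"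
    define g where "g i = f (x + (real i / real n) *\<^sub>R d)" for i
    have "f (x + d) - f x = (\<Sum>i<n. g (Suc i) - g i)"
      unfolding sum_lessThan_telescope using n by (simp add: g_def)
    also have "norm \<dots> \<le> (\<Sum>i<n. C * norm (d /\<^sub>R real n) * exp (B * norm (d /\<^sub>R real n)))"
    proof (rule sum_norm_le)
      fix i
      have "x + (real (Suc i) / real n) *\<^sub>R d = x + (real i / real n) *\<^sub>R d + d /\<^sub>R real n"
        by (simp add: add_divide_distrib algebra_simps divide_inverse)
      then show "norm (g (Suc i) - g i) \<le> C * norm (d /\<^sub>R real n) * exp (B * norm (d /\<^sub>R real n))"
        unfolding g_def using assms[of "x + (real i / real n) *\<^sub>R d" "d /\<^sub>R real n"] by (simp only:)
    qed
    also have "\<dots> = C * norm d * exp (B * norm d * inverse (real n))"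
      using n by (simp add: field_simps)
    finally show "norm (f (x + d) - f x) \<le> \<dots>" .
  qed
qed

context bounded_law
begin

text \<open>Up to normalisation, the law tilted at \<open>z + d\<close> is the one tilted at
  \<open>z\<close> with a further factor \<open>exp (v \<bullet> y)\<close>,
  \<open>v = s *\<^sub>R d\<close>. The first-order estimate for that factor is then globalised by
  subdivision.\<close>

lemma tilt_mean_lipschitz:
  assumes "0 \<le> s"
  shows "norm (tilt_mean \<nu> s x - tilt_mean \<nu> s z) \<le> s * K\<^sup>2 * norm (x - z)"
proof -
  have "norm (tilt_mean \<nu> s (z + d) - tilt_mean \<nu> s z) \<le> s * K\<^sup>2 * norm d * exp (2 * K * s * norm d)" for z d
  proof -
    have "tilt_mean \<nu> s (z + d)
        = (\<integral>y. exp ((s *\<^sub>R d) \<bullet> y) *\<^sub>R y \<partial>tilted \<nu> s z) /\<^sub>R (\<integral>y. exp ((s *\<^sub>R d) \<bullet> y) \<partial>tilted \<nu> s z)"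
      using tilt_mass_pos[of s z]
      by (subst (1 2) integral_tilted)
         (auto simp: tilt_mean_def tilt_mass_def tilt_weight_add mult.commute)
    then show ?thesis
      using bounded_law.exp_tilt_diff_le[OF bounded_law_tilted, where v = "s *\<^sub>R d" and s1 = s and x1 = z] assms
      by (simp add: tilt_mean_eq_tilted[of s z] mult_ac)
  qed
  from lipschitz_if_locally_lipschitz[of "tilt_mean \<nu> s" "s * K\<^sup>2" "2 * K * s", OF this, of z "x - z"]
  show ?thesis by simp
qed

end

section \<open>Euler steps and their randomisation\<close>

text \<open>Since \<^term>\<open>tilted \<nu> s x\<close> is the law of \<open>\<eta>\<close> given \<open>s \<eta> + Z = x\<close> for \<open>\<eta>\<close> of law \<open>\<nu>\<close> and
  an independent standard Gaussian \<open>Z\<close>, one step of this kernel turns the law of \<open>s \<eta> + Z\<close>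
  exactly into that of \<open>(s + h) \<eta> + Z\<close>.\<close>
definition posterior_step ::
    "'a::euclidean_space measure \<Rightarrow> real \<Rightarrow> real \<Rightarrow> ('a \<Rightarrow> ennreal) \<Rightarrow> 'a \<Rightarrow> ennreal" where
  "posterior_step \<nu> h s f x = (\<integral>\<^sup>+y. f (x + h *\<^sub>R y) \<partial>tilted \<nu> s x)"

text \<open>The chain is encoded by its action on test functions: the value at \<open>z\<close> is
  the expectation of \<open>f\<close> after \<open>k\<close> steps from \<open>z\<close>, and no
  path space is built. The last step is peeled off first, which matches the recursion of
  \<open>euler\<close>.\<close>

primrec step_iter ::
    "'a::euclidean_space measure \<Rightarrow> real \<Rightarrow> nat \<Rightarrow> ('a \<Rightarrow> ennreal) \<Rightarrow> 'a \<Rightarrow> ennreal" where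
  "step_iter \<nu> h 0 f = f"
| "step_iter \<nu> h (Suc k) f = step_iter \<nu> h k (posterior_step \<nu> h (real k * h) f)"

primrec euler :: "'a::euclidean_space measure \<Rightarrow> real \<Rightarrow> nat \<Rightarrow> 'a \<Rightarrow> 'a" where
  "euler \<nu> h 0 x = x"
| "euler \<nu> h (Suc k) x = euler \<nu> h k x + h *\<^sub>R tilt_mean \<nu> (real k * h) (euler \<nu> h k x)"

lemma rho_measurable [measurable]: "rho s \<in> borel_measurable borel"
  unfolding rho_def by measurable

lemma rho_nonneg [simp]: "0 \<le> rho s x"
  by (simp add: rho_def)

text \<open>The weight is the likelihood ratio at \<open>x\<close> of the unit Gaussian centred at
  \<open>s *\<^sub>R y\<close> against the one centred at 0. Averaging over \<open>y\<close> shows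
  that \<open>rho 1 x * tilt_mass \<nu> s x\<close> is the density of s \<eta> + Z.\<close>

lemma rho_mult_tilt_weight: "rho 1 x * tilt_weight s x y = rho 1 (x - s *\<^sub>R y)"
proof -
  have n: "(norm (x - s *\<^sub>R y))\<^sup>2 = (norm x)\<^sup>2 - 2 * s * (x \<bullet> y) + s\<^sup>2 * (norm y)\<^sup>2"
    unfolding power2_norm_eq_inner
    by (simp add: inner_diff_left inner_diff_right inner_commute power2_eq_square algebra_simps)
  have "- (norm (x - s *\<^sub>R y))\<^sup>2 / 2 = - (norm x)\<^sup>2 / 2 + (s * (x \<bullet> y) - s\<^sup>2 * (norm y)\<^sup>2 / 2)"
    unfolding n by (simp add: field_simps)
  then show ?thesis by (simp add: rho_def tilt_weight_def exp_add[symmetric])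
qed

text \<open>Squaring doubles the clock at the price of a factor free of \<open>x\<close>, so second
  moments of weights are Gaussian integrals again.\<close>

lemma tilt_weight_sq: "(tilt_weight s x y)\<^sup>2 = exp (s\<^sup>2 * (norm y)\<^sup>2) * tilt_weight (2 * s) x y"
  by (simp add: tilt_weight_def exp_add[symmetric] power2_eq_square[of "exp _"] algebra_simps
      power_mult_distrib)

lemma nn_integral_lborel_shift:
  fixes f :: "'a::euclidean_space \<Rightarrow> ennreal"
  assumes [measurable]: "f \<in> borel_measurable borel"
  shows "(\<integral>\<^sup>+x. f (x + c) \<partial>lborel) = (\<integral>\<^sup>+x. f x \<partial>lborel)"
proof -
  have "(\<integral>\<^sup>+x. f x \<partial>lborel) = (\<integral>\<^sup>+x. f x \<partial>distr lborel borel ((+) c))"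
    by (simp add: lborel_distr_plus)
  also have "\<dots> = (\<integral>\<^sup>+x. f (c + x) \<partial>lborel)" by (subst nn_integral_distr) auto
  finally show ?thesis by (simp add: add.commute)
qed

section \<open>The randomised chain: its exact law and its distance from the Euler scheme\<close>

context bounded_law
begin

lemma tilt_mass_measurable [measurable]: "tilt_mass \<nu> s \<in> borel_measurable borel"
  unfolding tilt_mass_def[abs_def] by measurable

lemma tilt_mean_measurable [measurable]: "tilt_mean \<nu> s \<in> borel_measurable borel"
  unfolding tilt_mean_def[abs_def] by measurable

lemma euler_measurable [measurable]: "euler \<nu> h k \<in> borel_measurable borel"
proof (induction k)
  case (Suc k)
  note [measurable] = Suc
  show ?case unfolding euler.simps(2)[abs_def] by measurable
qed simp

lemma posterior_step_eq:
  assumes [measurable]: "f \<in> borel_measurable borel"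
  shows "posterior_step \<nu> h s f x
    = (\<integral>\<^sup>+y. ennreal (tilt_weight s x y / tilt_mass \<nu> s x) * f (x + h *\<^sub>R y) \<partial>\<nu>)"
  unfolding posterior_step_def by (subst nn_integral_tilted) auto

lemma posterior_step_measurable [measurable]:
  assumes [measurable]: "f \<in> borel_measurable borel"
  shows "posterior_step \<nu> h s f \<in> borel_measurable borel"
  by (subst measurable_cong[OF posterior_step_eq[OF assms]]) measurable

lemma posterior_step_mono: "(\<And>x. f x \<le> g x) \<Longrightarrow> posterior_step \<nu> h s f x \<le> posterior_step \<nu> h s g x"
  unfolding posterior_step_def by (intro nn_integral_mono) auto

lemma measurable_shift_tilted:
  assumes [measurable]: "f \<in> borel_measurable borel"
  shows "(\<lambda>y. f (x + h *\<^sub>R y)) \<in> borel_measurable (tilted \<nu> s x)"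
proof -
  have "(\<lambda>y. f (x + h *\<^sub>R y)) \<in> borel_measurable \<nu>" by measurable
  then show ?thesis unfolding tilted_def by simp
qed

lemma posterior_step_affine:
  assumes "f \<in> borel_measurable borel" "g \<in> borel_measurable borel"
  shows "posterior_step \<nu> h s (\<lambda>x. f x + a * g x + b) x = posterior_step \<nu> h s f x + a * posterior_step \<nu> h s g x + b"
proof -
  interpret t: bounded_law "tilted \<nu> s x" K by (rule bounded_law_tilted)
  note [measurable] = measurable_shift_tilted[OF assms(1)] measurable_shift_tilted[OF assms(2)]
  show ?thesis unfolding posterior_step_def
    by (simp add: nn_integral_add nn_integral_cmult t.emeasure_space_1)
qed

lemma step_iter_measurable [measurable]:
  "f \<in> borel_measurable borel \<Longrightarrow> step_iter \<nu> h k f \<in> borel_measurable borel"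
  by (induction k arbitrary: f) auto

lemma step_iter_mono:
  assumes "\<And>x. f x \<le> g x"
  shows "step_iter \<nu> h k f x \<le> step_iter \<nu> h k g x"
  using assms
proof (induction k arbitrary: f g)
  case (Suc k)
  show ?case unfolding step_iter.simps by (intro Suc.IH posterior_step_mono Suc.prems)
qed simp

text \<open>Every kernel is linear and of mass one, so constants pass through. One scaled and one
  constant term are what the mean-square recursion and the passage to a test function
  require.\<close>

lemma step_iter_affine:
  assumes "f \<in> borel_measurable borel" "g \<in> borel_measurable borel"
  shows "step_iter \<nu> h k (\<lambda>x. f x + a * g x + b) x = step_iter \<nu> h k f x + a * step_iter \<nu> h k g x + b"
  using assms
proof (induction k arbitrary: f g)
  case (Suc k)
  have "posterior_step \<nu> h (real k * h) (\<lambda>x. f x + a * g x + b)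
      = (\<lambda>x. posterior_step \<nu> h (real k * h) f x + a * posterior_step \<nu> h (real k * h) g x + b)"
    using Suc.prems by (intro ext posterior_step_affine)
  then show ?case using Suc.prems by (simp add: Suc.IH posterior_step_measurable)
qed simp

lemma step_iter_const: "step_iter \<nu> h k (\<lambda>_. b) x = b"
proof -
  have "step_iter \<nu> h k (\<lambda>_. 0) x = 0"
  proof (induction k)
    case (Suc k)
    have "posterior_step \<nu> h (real k * h) (\<lambda>_. 0) = (\<lambda>_. 0)" by (simp add: fun_eq_iff posterior_step_def)
    then show ?case using Suc by simp
  qed simp
  then show ?thesis using step_iter_affine[of "\<lambda>_. 0" "\<lambda>_. 0" h k 0 b x] by simp
qed

text \<open>The weight \<open>rho 1 x * tilt_mass \<nu> s x\<close> cancels the normaliser of the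
  tilted law and leaves the joint density \<open>rho 1 (x - s *\<^sub>R y)\<close>. For fixed
  \<open>y\<close>, translating \<open>x\<close> by \<open>h *\<^sub>R y\<close> turns
  \<open>s\<close> into \<open>s + h\<close>.\<close>

lemma nn_integral_posterior_step:
  assumes [measurable]: "f \<in> borel_measurable borel"
  shows "(\<integral>\<^sup>+x. ennreal (rho 1 x * tilt_mass \<nu> s x) * posterior_step \<nu> h s f x \<partial>lborel)
    = (\<integral>\<^sup>+x. ennreal (rho 1 x * tilt_mass \<nu> (s + h) x) * f x \<partial>lborel)"
proof -
  interpret pair_sigma_finite lborel \<nu> ..
  have "(\<integral>\<^sup>+x. ennreal (rho 1 x * tilt_mass \<nu> s x) * posterior_step \<nu> h s f x \<partial>lborel)
      = (\<integral>\<^sup>+x. \<integral>\<^sup>+y. ennreal (rho 1 (x - s *\<^sub>R y)) * f (x + h *\<^sub>R y) \<partial>\<nu> \<partial>lborel)"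
  proof (rule nn_integral_cong)
    fix x :: 'a
    have "ennreal (rho 1 (x - s *\<^sub>R y))
        = ennreal (rho 1 x * tilt_mass \<nu> s x) * ennreal (tilt_weight s x y / tilt_mass \<nu> s x)" for y
      using tilt_mass_pos[of s x]
      by (subst ennreal_mult[symmetric]) (auto simp: rho_mult_tilt_weight less_imp_le)
    then show "ennreal (rho 1 x * tilt_mass \<nu> s x) * posterior_step \<nu> h s f x
        = (\<integral>\<^sup>+y. ennreal (rho 1 (x - s *\<^sub>R y)) * f (x + h *\<^sub>R y) \<partial>\<nu>)"
      by (simp add: posterior_step_eq mult.assoc nn_integral_cmult)
  qed
  also have "\<dots> = (\<integral>\<^sup>+y. \<integral>\<^sup>+x. ennreal (rho 1 (x - s *\<^sub>R y)) * f (x + h *\<^sub>R y) \<partial>lborel \<partial>\<nu>)"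
    by (rule Fubini'[symmetric]) measurable
  also have "\<dots> = (\<integral>\<^sup>+y. \<integral>\<^sup>+x. ennreal (rho 1 (x - (s + h) *\<^sub>R y)) * f x \<partial>lborel \<partial>\<nu>)"
  proof (rule nn_integral_cong)
    fix y :: 'a
    show "(\<integral>\<^sup>+x. ennreal (rho 1 (x - s *\<^sub>R y)) * f (x + h *\<^sub>R y) \<partial>lborel)
        = (\<integral>\<^sup>+x. ennreal (rho 1 (x - (s + h) *\<^sub>R y)) * f x \<partial>lborel)"
      using nn_integral_lborel_shift[of "\<lambda>x. ennreal (rho 1 (x - (s + h) *\<^sub>R y)) * f x" "h *\<^sub>R y"]
      by (simp add: algebra_simps)
  qed
  also have "\<dots> = (\<integral>\<^sup>+x. \<integral>\<^sup>+y. ennreal (rho 1 (x - (s + h) *\<^sub>R y)) * f x \<partial>\<nu> \<partial>lborel)"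
    by (rule Fubini') measurable
  also have "\<dots> = (\<integral>\<^sup>+x. ennreal (rho 1 x * tilt_mass \<nu> (s + h) x) * f x \<partial>lborel)"
  proof (rule nn_integral_cong)
    fix x :: 'a
    have "(\<integral>\<^sup>+y. ennreal (rho 1 (x - (s + h) *\<^sub>R y)) \<partial>\<nu>) = (\<integral>\<^sup>+y. ennreal (rho 1 x * tilt_weight (s + h) x y) \<partial>\<nu>)"
      by (simp add: rho_mult_tilt_weight)
    also have "\<dots> = ennreal (\<integral>y. rho 1 x * tilt_weight (s + h) x y \<partial>\<nu>)"
      using integrable_tilt_weight[of "s + h" x] by (intro nn_integral_eq_integral) auto
    finally show "(\<integral>\<^sup>+y. ennreal (rho 1 (x - (s + h) *\<^sub>R y)) * f x \<partial>\<nu>) = ennreal (rho 1 x * tilt_mass \<nu> (s + h) x) * f x"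
      by (simp add: nn_integral_multc tilt_mass_def)
  qed
  finally show ?thesis .
qed

text \<open>At clock 0 all weights are 1, so the chain starts from the standard Gaussian; each step
  then advances the density without discretisation error.\<close>

lemma nn_integral_step_iter:
  assumes "f \<in> borel_measurable borel"
  shows "(\<integral>\<^sup>+x. ennreal (rho 1 x) * step_iter \<nu> h k f x \<partial>lborel)
    = (\<integral>\<^sup>+x. ennreal (rho 1 x * tilt_mass \<nu> (real k * h) x) * f x \<partial>lborel)"
  using assms
proof (induction k arbitrary: f)
  case 0
  have "tilt_mass \<nu> 0 x = 1" for x by (simp add: tilt_mass_def tilt_weight_def prob_space)
  then show ?case by simp
next
  case (Suc k)
  show ?case unfolding step_iter.simps Suc.IH[OF posterior_step_measurable[OF Suc.prems]]
      nn_integral_posterior_step[OF Suc.prems]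
    by (simp add: distrib_right add.commute)
qed

text \<open>From \<open>x\<close> the randomised step has mean
  \<open>x + h *\<^sub>R tilt_mean \<nu> s x\<close>. Its distance to the Euler step from
  \<open>z\<close> grows by the Lipschitz factor, and the variance contributes
  \<open>h\<^sup>2 * K\<^sup>2\<close> separately.\<close>

lemma posterior_step_sq_le:
  assumes "0 \<le> s" "0 < h"
  shows "posterior_step \<nu> h s (\<lambda>x. ennreal ((norm (x - (z + h *\<^sub>R tilt_mean \<nu> s z)))\<^sup>2)) x
    \<le> ennreal ((1 + h * s * K\<^sup>2)\<^sup>2 * (norm (x - z))\<^sup>2 + h\<^sup>2 * K\<^sup>2)"
proof -
  interpret t: bounded_law "tilted \<nu> s x" K by (rule bounded_law_tilted)
  define c where "c = z + h *\<^sub>R tilt_mean \<nu> s z"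
  \<comment> \<open>The value of \<open>y\<close> for which the step from \<open>x\<close> would hit
    the target \<open>c\<close> exactly; it reduces the claim to the decomposition about
    \<open>a\<close>.\<close>
  define a where "a = (c - x) /\<^sub>R h"
  define m where "m = tilt_mean \<nu> s x"
  have sq: "(norm (x + h *\<^sub>R y - c))\<^sup>2 = h\<^sup>2 * (norm (y - a))\<^sup>2" for y
  proof -
    have "x + h *\<^sub>R y - c = h *\<^sub>R (y - a)" using assms by (simp add: a_def algebra_simps)
    then show ?thesis by (simp add: power_mult_distrib)
  qed
  have "posterior_step \<nu> h s (\<lambda>x. ennreal ((norm (x - c))\<^sup>2)) x
      = ennreal (\<integral>y. h\<^sup>2 * (norm (y - a))\<^sup>2 \<partial>tilted \<nu> s x)"
    unfolding posterior_step_def sq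
    by (intro nn_integral_eq_integral integrable_mult_right t.integrable_norm_diff_sq) auto
  also have "(\<integral>y. h\<^sup>2 * (norm (y - a))\<^sup>2 \<partial>tilted \<nu> s x)
      = h\<^sup>2 * (norm (m - a))\<^sup>2 + h\<^sup>2 * ((\<integral>y. (norm y)\<^sup>2 \<partial>tilted \<nu> s x) - (norm m)\<^sup>2)"
    by (simp add: t.integral_norm_diff_sq m_def tilt_mean_eq_tilted algebra_simps)
  also have "\<dots> \<le> (1 + h * s * K\<^sup>2)\<^sup>2 * (norm (x - z))\<^sup>2 + h\<^sup>2 * K\<^sup>2"
  proof (rule add_mono)
    have "norm (h *\<^sub>R (m - a)) = norm ((x - z) + h *\<^sub>R (m - tilt_mean \<nu> s z))"
      using assms by (simp add: a_def c_def algebra_simps)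
    also have "\<dots> \<le> norm (x - z) + h * (s * K\<^sup>2 * norm (x - z))"
      using assms tilt_mean_lipschitz[of s x z] unfolding m_def
      by (intro order_trans[OF norm_triangle_ineq] add_mono) auto
    also have "\<dots> = (1 + h * s * K\<^sup>2) * norm (x - z)" by (simp add: algebra_simps)
    finally have "(norm (h *\<^sub>R (m - a)))\<^sup>2 \<le> ((1 + h * s * K\<^sup>2) * norm (x - z))\<^sup>2"
      by (intro power_mono) auto
    then show "h\<^sup>2 * (norm (m - a))\<^sup>2 \<le> (1 + h * s * K\<^sup>2)\<^sup>2 * (norm (x - z))\<^sup>2"
      by (simp add: power_mult_distrib)
    have "(\<integral>y. (norm y)\<^sup>2 \<partial>tilted \<nu> s x) - (norm m)\<^sup>2 \<le> K\<^sup>2"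
      using t.integral_norm_sq_le by (smt (verit) zero_le_power2)
    then show "h\<^sup>2 * ((\<integral>y. (norm y)\<^sup>2 \<partial>tilted \<nu> s x) - (norm m)\<^sup>2) \<le> h\<^sup>2 * K\<^sup>2"
      by (intro mult_left_mono) auto
  qed
  finally show ?thesis by (simp add: c_def ennreal_leI)
qed

text \<open>Given the past the noise is centred, so variances of size
  \<open>h\<^sup>2 * K\<^sup>2\<close> add up instead of errors of size \<open>h * K\<close>. Over
  at most \<open>\<tau> / h\<close> steps the total is of order \<open>h\<close>.\<close>

lemma step_iter_euler_sq_le:
  assumes "0 < h" "real k * h \<le> \<tau>"
  shows "step_iter \<nu> h k (\<lambda>x. ennreal ((norm (x - euler \<nu> h k z))\<^sup>2)) z
    \<le> ennreal (h\<^sup>2 * K\<^sup>2 * real k * ((1 + h * \<tau> * K\<^sup>2)\<^sup>2) ^ k)"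
  using assms(2)
proof (induction k)
  case (Suc k)
  define a where "a = (1 + h * \<tau> * K\<^sup>2)\<^sup>2"
  have kt: "real k * h \<le> \<tau>" using Suc.prems \<open>0 < h\<close> by (simp add: algebra_simps)
  have t0: "0 \<le> \<tau>" using kt \<open>0 < h\<close> by (meson mult_nonneg_nonneg of_nat_0_le_iff less_imp_le order_trans)
  have a1: "1 \<le> a" unfolding a_def using t0 \<open>0 < h\<close> by (intro one_le_power) auto
  have a2: "(1 + h * (real k * h) * K\<^sup>2)\<^sup>2 \<le> a" unfolding a_def using kt \<open>0 < h\<close>
    by (intro power_mono add_left_mono mult_right_mono mult_left_mono) auto
  have "step_iter \<nu> h (Suc k) (\<lambda>x. ennreal ((norm (x - euler \<nu> h (Suc k) z))\<^sup>2)) z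
      \<le> step_iter \<nu> h k (\<lambda>x. 0 + ennreal a * ennreal ((norm (x - euler \<nu> h k z))\<^sup>2) + ennreal (h\<^sup>2 * K\<^sup>2)) z"
    unfolding step_iter.simps euler.simps
  proof (rule step_iter_mono)
    fix x
    have "posterior_step \<nu> h (real k * h)
        (\<lambda>x. ennreal ((norm (x - (euler \<nu> h k z + h *\<^sub>R tilt_mean \<nu> (real k * h) (euler \<nu> h k z))))\<^sup>2)) x
      \<le> ennreal ((1 + h * (real k * h) * K\<^sup>2)\<^sup>2 * (norm (x - euler \<nu> h k z))\<^sup>2 + h\<^sup>2 * K\<^sup>2)"
      using \<open>0 < h\<close> by (intro posterior_step_sq_le) auto
    also have "\<dots> \<le> ennreal (a * (norm (x - euler \<nu> h k z))\<^sup>2 + h\<^sup>2 * K\<^sup>2)"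
      by (intro ennreal_leI add_right_mono mult_right_mono a2) auto
    also have "\<dots> = 0 + ennreal a * ennreal ((norm (x - euler \<nu> h k z))\<^sup>2) + ennreal (h\<^sup>2 * K\<^sup>2)"
      using a1 by (simp add: ennreal_mult ennreal_plus)
    finally show "posterior_step \<nu> h (real k * h)
        (\<lambda>x. ennreal ((norm (x - (euler \<nu> h k z + h *\<^sub>R tilt_mean \<nu> (real k * h) (euler \<nu> h k z))))\<^sup>2)) x \<le> \<dots>" .
  qed
  also have "\<dots> = ennreal a * step_iter \<nu> h k (\<lambda>x. ennreal ((norm (x - euler \<nu> h k z))\<^sup>2)) z + ennreal (h\<^sup>2 * K\<^sup>2)"
    by (subst step_iter_affine) (auto simp: step_iter_const)
  also have "\<dots> \<le> ennreal a * ennreal (h\<^sup>2 * K\<^sup>2 * real k * a ^ k) + ennreal (h\<^sup>2 * K\<^sup>2)"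
    using Suc.IH[OF kt] unfolding a_def by (intro add_right_mono mult_left_mono) auto
  also have "\<dots> = ennreal (h\<^sup>2 * K\<^sup>2 * real k * a ^ Suc k + h\<^sup>2 * K\<^sup>2)"
    using a1 by (simp add: ennreal_mult[symmetric] ennreal_plus[symmetric] mult_ac del: ennreal_plus)
  also have "\<dots> \<le> ennreal (h\<^sup>2 * K\<^sup>2 * real (Suc k) * a ^ Suc k)"
  proof (rule ennreal_leI)
    have "h\<^sup>2 * K\<^sup>2 * 1 \<le> h\<^sup>2 * K\<^sup>2 * a ^ Suc k" using a1 by (intro mult_left_mono one_le_power) auto
    then show "h\<^sup>2 * K\<^sup>2 * real k * a ^ Suc k + h\<^sup>2 * K\<^sup>2 \<le> h\<^sup>2 * K\<^sup>2 * real (Suc k) * a ^ Suc k"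
      by (simp add: algebra_simps)
  qed
  finally show ?case unfolding a_def .
qed simp

text \<open>The Euler point is exchanged for the chain, whose law from a Gaussian start is known
  exactly. For Lipschitz \<open>F\<close> the exchange costs a multiple of the root mean square
  distance, hence the order \<open>sqrt h\<close>.\<close>

lemma nn_integral_euler_le:
  fixes F :: "'a \<Rightarrow> ennreal"
  assumes [measurable]: "F \<in> borel_measurable borel"
    and lip: "\<And>x z. F z \<le> F x + ennreal (c * norm (x - z))"
    and c: "0 \<le> c" and h: "0 < h" and k: "real k * h \<le> \<tau>"
    and prob: "prob_space (density lborel (rho 1 :: 'a \<Rightarrow> real))"
  shows "(\<integral>\<^sup>+z. F (euler \<nu> h k z) \<partial>density lborel (rho 1))
    \<le> (\<integral>\<^sup>+x. ennreal (rho 1 x * tilt_mass \<nu> (real k * h) x) * F x \<partial>lborel)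
      + ennreal (c * (1 + \<tau> * K\<^sup>2 * exp (2 * \<tau>\<^sup>2 * K\<^sup>2)) * sqrt h)"
proof -
  define C where "C = \<tau> * K\<^sup>2 * exp (2 * \<tau>\<^sup>2 * K\<^sup>2)"
  define r where "r = sqrt h"
  have r: "0 < r" "r * r = h" using h by (auto simp: r_def)
  have t0: "0 \<le> \<tau>" using k h by (meson mult_nonneg_nonneg of_nat_0_le_iff less_imp_le order_trans)
  have C0: "0 \<le> C" using t0 by (simp add: C_def)
  \<comment> \<open>One factor \<open>h\<close> is spent on \<open>real k * h \<le> \<tau>\<close>,
    and the power is at most \<open>exp (2 * (real k * h) * \<tau> * K\<^sup>2)\<close>.\<close>
  have C: "h\<^sup>2 * K\<^sup>2 * real k * ((1 + h * \<tau> * K\<^sup>2)\<^sup>2) ^ k \<le> C * h"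
  proof -
    have "((1 + h * \<tau> * K\<^sup>2)\<^sup>2) ^ k \<le> ((exp (h * \<tau> * K\<^sup>2))\<^sup>2) ^ k"
      using h t0 by (intro power_mono exp_ge_add_one_self) auto
    also have "\<dots> = exp (2 * (real k * h) * \<tau> * K\<^sup>2)"
      by (simp add: exp_of_nat_mult[symmetric] exp_double[symmetric] mult_ac)
    also have "\<dots> \<le> exp (2 * \<tau>\<^sup>2 * K\<^sup>2)"
    proof -
      have "real k * h * (2 * \<tau> * K\<^sup>2) \<le> \<tau> * (2 * \<tau> * K\<^sup>2)"
        using k t0 by (intro mult_right_mono) auto
      then show ?thesis by (simp add: power2_eq_square mult_ac)
    qed
    finally have "(real k * h) * (h * K\<^sup>2 * ((1 + h * \<tau> * K\<^sup>2)\<^sup>2) ^ k) \<le> \<tau> * (h * K\<^sup>2 * exp (2 * \<tau>\<^sup>2 * K\<^sup>2))"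
      using k h t0 by (intro mult_mono mult_left_mono) auto
    then show ?thesis by (simp add: C_def power2_eq_square mult_ac)
  qed
  have pt: "F (euler \<nu> h k z) \<le> step_iter \<nu> h k F z + ennreal (c * (1 + C) * r)" for z
  proof -
    let ?e = "euler \<nu> h k z"
    \<comment> \<open>Read as the chain expectation of a constant, the value at the Euler point can
      be compared with \<open>F\<close> under the chain. Distances are bounded by d <= d^2 / r + r;
      as the mean of d^2 is at most \<open>C * h\<close>, taking \<open>r = sqrt h\<close> balances
      both terms.\<close>
    have "F ?e = step_iter \<nu> h k (\<lambda>_. F ?e) z" by (simp add: step_iter_const)
    also have "\<dots> \<le> step_iter \<nu> h k (\<lambda>x. F x + ennreal (c / r) * ennreal ((norm (x - ?e))\<^sup>2) + ennreal (c * r)) z"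
    proof (rule step_iter_mono)
      fix x
      have "c * norm (x - ?e) \<le> c * ((norm (x - ?e))\<^sup>2 / r + r)"
      proof (rule mult_left_mono[OF _ c])
        have "2 * norm (x - ?e) * r \<le> (norm (x - ?e))\<^sup>2 + r\<^sup>2" by (rule sum_squares_bound)
        moreover have "0 \<le> norm (x - ?e) * r" using r by simp
        ultimately have "norm (x - ?e) * r \<le> (norm (x - ?e))\<^sup>2 + r\<^sup>2" by linarith
        then show "norm (x - ?e) \<le> (norm (x - ?e))\<^sup>2 / r + r"
          using r by (simp add: field_simps power2_eq_square)
      qed
      then have "F ?e \<le> F x + ennreal (c / r * (norm (x - ?e))\<^sup>2 + c * r)"
        using lip[of ?e x] by (auto intro: order_trans add_left_mono ennreal_leI simp: algebra_simps)
      then show "F ?e \<le> F x + ennreal (c / r) * ennreal ((norm (x - ?e))\<^sup>2) + ennreal (c * r)"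
        using c r
        by (simp add: ennreal_mult[symmetric] ennreal_plus[symmetric] add.assoc del: ennreal_plus)
    qed
    also have "\<dots> = step_iter \<nu> h k F z
        + ennreal (c / r) * step_iter \<nu> h k (\<lambda>x. ennreal ((norm (x - ?e))\<^sup>2)) z + ennreal (c * r)"
      by (rule step_iter_affine) auto
    also have "\<dots> \<le> step_iter \<nu> h k F z + ennreal (c / r) * ennreal (C * h) + ennreal (c * r)"
      using order_trans[OF step_iter_euler_sq_le[OF h k] ennreal_leI[OF C]]
      by (intro add_right_mono add_left_mono mult_left_mono) auto
    also have "\<dots> = step_iter \<nu> h k F z + ennreal (c / r * (C * h) + c * r)"
      using c r C0 h
      by (simp add: ennreal_mult[symmetric] ennreal_plus[symmetric] add.assoc del: ennreal_plus)
    also have "c / r * (C * h) + c * r = c * (1 + C) * r"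
      unfolding r(2)[symmetric] using r by (simp add: field_simps)
    finally show ?thesis .
  qed
  interpret g: prob_space "density lborel (rho 1 :: 'a \<Rightarrow> real)" by (rule prob)
  have "(\<integral>\<^sup>+z. F (euler \<nu> h k z) \<partial>density lborel (rho 1))
      \<le> (\<integral>\<^sup>+z. step_iter \<nu> h k F z + ennreal (c * (1 + C) * r) \<partial>density lborel (rho 1))"
    by (intro nn_integral_mono pt)
  also have "\<dots> = (\<integral>\<^sup>+z. step_iter \<nu> h k F z \<partial>density lborel (rho 1)) + ennreal (c * (1 + C) * r)"
    using g.emeasure_space_1 by (subst nn_integral_add) auto
  also have "(\<integral>\<^sup>+z. step_iter \<nu> h k F z \<partial>density lborel (rho 1))
      = (\<integral>\<^sup>+x. ennreal (rho 1 x * tilt_mass \<nu> (real k * h) x) * F x \<partial>lborel)"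
    by (subst nn_integral_density) (auto simp: nn_integral_step_iter)
  finally show ?thesis by (simp add: C_def r_def)
qed

end

section \<open>Convergence and stability of the Euler scheme\<close>

context bounded_law
begin

lemma tendsto_tilt_mean:
  assumes s: "s \<longlonglongrightarrow> s'" and x: "x \<longlonglongrightarrow> x'"
  shows "(\<lambda>n. tilt_mean \<nu> (s n) (x n)) \<longlonglongrightarrow> tilt_mean \<nu> s' x'"
proof -
  obtain A where A: "\<And>n. \<bar>s n\<bar> \<le> A" using convergent_imp_Bseq[OF convergentI[OF s]] by (auto simp: Bseq_def)
  obtain B where B: "\<And>n. norm (x n) \<le> B" using convergent_imp_Bseq[OF convergentI[OF x]] by (auto simp: Bseq_def)
  have w: "tilt_weight (s n) (x n) y \<le> exp (A * B * K)" if "norm y \<le> K" for n y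
  proof -
    have "\<bar>s n\<bar> * norm (x n) \<le> A * B"
      using A B order_trans[OF abs_ge_zero A[of n]] by (intro mult_mono) auto
    then have "\<bar>s n\<bar> * norm (x n) * K \<le> A * B * K" using K_nonneg by (rule mult_right_mono)
    then show ?thesis by (intro order_trans[OF tilt_weight_le[OF that]]) simp
  qed
  have lim: "(\<lambda>n. tilt_weight (s n) (x n) y) \<longlonglongrightarrow> tilt_weight s' x' y" for y
    unfolding tilt_weight_def by (intro tendsto_intros s x) simp
  have "(\<lambda>n. tilt_mass \<nu> (s n) (x n)) \<longlonglongrightarrow> tilt_mass \<nu> s' x'"
    unfolding tilt_mass_def
  proof (rule integral_dominated_convergence[where w = "\<lambda>_. exp (A * B * K)"])
    show "AE y in \<nu>. norm (tilt_weight (s n) (x n) y) \<le> exp (A * B * K)" for n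
      using AE_norm_le by eventually_elim (auto dest: w)
  qed (auto simp: lim)
  moreover have "(\<lambda>n. \<integral>y. tilt_weight (s n) (x n) y *\<^sub>R y \<partial>\<nu>) \<longlonglongrightarrow> (\<integral>y. tilt_weight s' x' y *\<^sub>R y \<partial>\<nu>)"
  proof (rule integral_dominated_convergence[where w = "\<lambda>_. exp (A * B * K) * K"])
    show "AE y in \<nu>. norm (tilt_weight (s n) (x n) y *\<^sub>R y) \<le> exp (A * B * K) * K" for n
      using AE_norm_le by eventually_elim (auto dest: w intro!: mult_mono)
  qed (auto intro!: tendsto_intros lim)
  ultimately show ?thesis unfolding tilt_mean_def
    using tilt_mass_pos[of s' x'] by (intro tendsto_intros) auto
qed

lemma continuous_on_tilt_mean:
  fixes S :: "real set"
  assumes "continuous_on S s" "continuous_on S x"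
  shows "continuous_on S (\<lambda>r. tilt_mean \<nu> (s r) (x r))"
  using assms unfolding continuous_on_sequentially comp_def by (auto intro!: tendsto_tilt_mean)

text \<open>The mean value inequality is applied in the original time to
  \<open>X - \<tau> c\<close>, with \<open>\<epsilon> \<tau>\<close> as majorant. Since
  \<open>\<tau>'\<close> is only nonnegative, the inverse of the clock may fail to be
  differentiable, and no derivative in \<open>\<tau>\<close> is taken.\<close>

lemma euler_local_error:
  assumes "a < b" and cont: "continuous_on {a..b} \<tau>" "continuous_on {a..b} X"
    and \<tau>': "\<And>r. a < r \<Longrightarrow> r < b \<Longrightarrow> (\<tau> has_vector_derivative \<tau>' r) (at r)"
    and \<tau>'_nonneg: "\<And>r. a < r \<Longrightarrow> r < b \<Longrightarrow> 0 \<le> \<tau>' r"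
    and X': "\<And>r. a < r \<Longrightarrow> r < b \<Longrightarrow> (X has_vector_derivative \<tau>' r *\<^sub>R v r) (at r)"
    and v: "\<And>r. a < r \<Longrightarrow> r < b \<Longrightarrow> norm (v r - c) \<le> \<epsilon>"
  shows "norm (X b - X a - (\<tau> b - \<tau> a) *\<^sub>R c) \<le> \<epsilon> * (\<tau> b - \<tau> a)"
proof -
  have "norm ((X b - \<tau> b *\<^sub>R c) - (X a - \<tau> a *\<^sub>R c)) \<le> \<epsilon> * \<tau> b - \<epsilon> * \<tau> a"
  proof (rule differentiable_bound_general[OF \<open>a < b\<close>, where f' = "\<lambda>r. \<tau>' r *\<^sub>R (v r - c)" and \<phi>' = "\<lambda>r. \<epsilon> * \<tau>' r"])
    fix r assume r: "a < r" "r < b"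
    show "((\<lambda>r. X r - \<tau> r *\<^sub>R c) has_vector_derivative \<tau>' r *\<^sub>R (v r - c)) (at r)"
      unfolding scaleR_diff_right using X'[OF r] \<tau>'[OF r]
      by (auto intro!: derivative_eq_intros simp: has_real_derivative_iff_has_vector_derivative)
    show "((\<lambda>r. \<epsilon> * \<tau> r) has_vector_derivative \<epsilon> * \<tau>' r) (at r)"
      using \<tau>'[OF r] by (auto intro!: derivative_eq_intros)
    show "norm (\<tau>' r *\<^sub>R (v r - c)) \<le> \<epsilon> * \<tau>' r"
      using mult_left_mono[OF v[OF r] \<tau>'_nonneg[OF r]] \<tau>'_nonneg[OF r] by (simp add: mult.commute)
  qed (intro continuous_intros cont)+
  then show ?thesis by (simp add: algebra_simps)
qed

text \<open>The grid is uniform in the clock and is pulled back to time by its inverse. Uniform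
  continuity of the field along the solution gives a defect of at most \<open>\<epsilon> * h\<close>
  per step, and the Lipschitz bound propagates it.\<close>

lemma euler_converges:
  assumes t: "0 < t" and \<tau>0: "\<tau> 0 = 0"
    and cont: "continuous_on {0..t} \<tau>" "continuous_on {0..t} X"
    and incr: "\<And>r u. 0 \<le> r \<Longrightarrow> r < u \<Longrightarrow> u \<le> t \<Longrightarrow> \<tau> r < \<tau> u"
    and \<tau>': "\<And>r. 0 < r \<Longrightarrow> r < t \<Longrightarrow> (\<tau> has_vector_derivative \<tau>' r) (at r)"
    and \<tau>'_nonneg: "\<And>r. 0 < r \<Longrightarrow> r < t \<Longrightarrow> 0 \<le> \<tau>' r"
    and X': "\<And>r. 0 < r \<Longrightarrow> r < t \<Longrightarrow>
        (X has_vector_derivative \<tau>' r *\<^sub>R tilt_mean \<nu> (\<tau> r) (X r)) (at r)"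
  shows "(\<lambda>n. euler \<nu> (\<tau> t / real n) n (X 0)) \<longlonglongrightarrow> X t"
proof -
  define G where "G = the_inv_into {0..t} \<tau>"
  have inj: "inj_on \<tau> {0..t}"
    by (rule linorder_inj_onI) (use incr in \<open>auto simp: less_imp_neq\<close>)
  have Gt: "G (\<tau> r) = r" if "r \<in> {0..t}" for r
    unfolding G_def using the_inv_into_f_f[OF inj that] .
  have \<tau>t: "0 < \<tau> t" using incr[of 0 t] t \<tau>0 by simp
  have mono: "\<tau> r \<le> \<tau> u" if "0 \<le> r" "r \<le> u" "u \<le> t" for r u
    using incr[of r u] that by (cases "r = u") auto
  have img: "\<tau> ` {0..t} = {0..\<tau> t}"
  proof
    show "\<tau> ` {0..t} \<subseteq> {0..\<tau> t}" using mono[of 0] mono[of _ t] \<tau>0 by auto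
    show "{0..\<tau> t} \<subseteq> \<tau> ` {0..t}"
      using IVT'[OF _ _ _ cont(1)] \<tau>0 t by (force simp: image_iff)
  qed
  have Gcont: "continuous_on {0..\<tau> t} G"
    using continuous_on_inv[OF cont(1) compact_Icc, of G] Gt by (simp add: img)
  have G: "G u \<in> {0..t}" "\<tau> (G u) = u" if u: "u \<in> {0..\<tau> t}" for u
  proof -
    from u obtain r where "r \<in> {0..t}" "u = \<tau> r" unfolding img[symmetric] by auto
    then show "G u \<in> {0..t}" "\<tau> (G u) = u" using Gt by auto
  qed
  define g where "g u = tilt_mean \<nu> u (X (G u))" for u
  have "continuous_on {0..\<tau> t} g"
    unfolding g_def using G
    by (intro continuous_on_tilt_mean continuous_on_compose2[OF cont(2) Gcont] continuous_intros) auto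
  then have unif: "uniformly_continuous_on {0..\<tau> t} g"
    by (rule compact_uniformly_continuous) simp
  define L where "L = \<tau> t * K\<^sup>2"
  have L: "0 \<le> L" using \<tau>t by (simp add: L_def)
  show ?thesis
  proof (rule LIMSEQ_I)
    fix e :: real assume e: "0 < e"
    \<comment> \<open>Chosen so that the accumulated error
      \<open>\<tau> t * \<epsilon> * exp (L * \<tau> t)\<close> equals \<open>e / 2\<close>.\<close>
    define \<epsilon> where "\<epsilon> = e / (2 * (\<tau> t * exp (L * \<tau> t)))"
    have \<epsilon>: "0 < \<epsilon>" using e \<tau>t by (simp add: \<epsilon>_def)
    obtain \<delta> where \<delta>: "0 < \<delta>"
      "\<And>u v. u \<in> {0..\<tau> t} \<Longrightarrow> v \<in> {0..\<tau> t} \<Longrightarrow> dist v u < \<delta> \<Longrightarrow> dist (g v) (g u) < \<epsilon>"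
      using unif \<epsilon> unfolding uniformly_continuous_on_def by metis
    obtain N where N: "\<tau> t / \<delta> < real N" using reals_Archimedean2 by blast
    show "\<exists>N. \<forall>n\<ge>N. norm (euler \<nu> (\<tau> t / real n) n (X 0) - X t) < e"
    proof (intro exI allI impI)
      fix n assume n: "max N 1 \<le> n"
      define h where "h = \<tau> t / real n"
      have h: "0 < h" "real n * h = \<tau> t" using n \<tau>t by (auto simp: h_def)
      have "\<tau> t / \<delta> < real n" using N n by simp
      then have hd: "h < \<delta>" using n \<delta>(1) by (simp add: h_def field_simps)
      have mem: "real k * h \<in> {0..\<tau> t}" if "k \<le> n" for k
        using that h(1) unfolding h(2)[symmetric] by (auto intro: mult_right_mono)
      define x where "x k = euler \<nu> h k (X 0)" for k
      have err: "norm (x k - X (G (real k * h))) \<le> real k * h * \<epsilon> * (1 + h * L) ^ k" if "k \<le> n" for k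
        using that
      proof (induction k)
        case 0
        then show ?case using Gt[of 0] \<tau>0 t by (simp add: x_def)
      next
        case (Suc k)
        define a where "a = G (real k * h)"
        define b where "b = G (real (Suc k) * h)"
        have ab: "a \<in> {0..t}" "b \<in> {0..t}" "\<tau> a = real k * h" "\<tau> b = real (Suc k) * h"
          unfolding a_def b_def using G[OF mem[of k]] G[OF mem[of "Suc k"]] Suc.prems by simp_all
        have kh: "real k * h \<le> \<tau> t" using mem[of k] Suc.prems by simp
        have \<tau>ab: "\<tau> b - \<tau> a = h" by (simp add: ab algebra_simps)
        have "a < b"
          using mono[of b a] ab \<tau>ab h(1) by (force simp: not_less[symmetric])
        have "norm (X b - X a - (\<tau> b - \<tau> a) *\<^sub>R tilt_mean \<nu> (\<tau> a) (X a)) \<le> \<epsilon> * (\<tau> b - \<tau> a)"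
        proof (rule euler_local_error[OF \<open>a < b\<close>, where \<tau>' = \<tau>' and v = "\<lambda>r. tilt_mean \<nu> (\<tau> r) (X r)"])
          show "continuous_on {a..b} \<tau>" "continuous_on {a..b} X"
            using ab by (auto intro: continuous_on_subset[OF cont(1)] continuous_on_subset[OF cont(2)])
          fix r assume r: "a < r" "r < b"
          then have r': "0 < r" "r < t" "r \<in> {0..t}" using ab by auto
          show "(\<tau> has_vector_derivative \<tau>' r) (at r)" "0 \<le> \<tau>' r"
            "(X has_vector_derivative \<tau>' r *\<^sub>R tilt_mean \<nu> (\<tau> r) (X r)) (at r)"
            using \<tau>' \<tau>'_nonneg X' r' by auto
          have \<tau>r: "\<tau> a \<le> \<tau> r" "\<tau> r \<le> \<tau> b" "\<tau> r \<in> {0..\<tau> t}" "\<tau> a \<in> {0..\<tau> t}"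
            using mono[of a r] mono[of r b] r ab(1,2) r' img by auto
          then have "dist (\<tau> r) (\<tau> a) < \<delta>" using \<tau>ab hd by (simp add: dist_real_def)
          from \<delta>(2)[OF \<tau>r(4,3) this]
          show "norm (tilt_mean \<nu> (\<tau> r) (X r) - tilt_mean \<nu> (\<tau> a) (X a)) \<le> \<epsilon>"
            using Gt[OF ab(1)] Gt[OF r'(3)] by (simp add: g_def dist_norm)
        qed
        then have le: "norm (X a + h *\<^sub>R tilt_mean \<nu> (real k * h) (X a) - X b) \<le> \<epsilon> * h"
          unfolding \<tau>ab unfolding ab(3) by (subst norm_minus_commute) (simp add: algebra_simps)
        have "x (Suc k) - X b = (x k - X a)
            + h *\<^sub>R (tilt_mean \<nu> (real k * h) (x k) - tilt_mean \<nu> (real k * h) (X a))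
            + (X a + h *\<^sub>R tilt_mean \<nu> (real k * h) (X a) - X b)"
          by (simp add: x_def algebra_simps)
        also have "norm \<dots> \<le> norm (x k - X a) + h * (L * norm (x k - X a)) + \<epsilon> * h"
        proof (intro order_trans[OF norm_triangle_ineq] add_mono le order_refl)
          have "norm (tilt_mean \<nu> (real k * h) (x k) - tilt_mean \<nu> (real k * h) (X a))
              \<le> real k * h * K\<^sup>2 * norm (x k - X a)" using h by (intro tilt_mean_lipschitz) auto
          also have "\<dots> \<le> L * norm (x k - X a)"
            unfolding L_def using kh by (intro mult_right_mono) auto
          finally show "norm (h *\<^sub>R (tilt_mean \<nu> (real k * h) (x k) - tilt_mean \<nu> (real k * h) (X a)))
              \<le> h * (L * norm (x k - X a))" using h by simp
        qed
        also have "\<dots> = (1 + h * L) * norm (x k - X a) + \<epsilon> * h" by (simp add: algebra_simps)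
        also have "\<dots> \<le> (1 + h * L) * (real k * h * \<epsilon> * (1 + h * L) ^ k) + \<epsilon> * h * (1 + h * L) ^ Suc k"
        proof (intro add_mono mult_left_mono)
          show "norm (x k - X a) \<le> real k * h * \<epsilon> * (1 + h * L) ^ k" using Suc unfolding a_def by simp
          have "\<epsilon> * h * 1 \<le> \<epsilon> * h * (1 + h * L) ^ Suc k"
            using \<epsilon> h L by (intro mult_left_mono one_le_power) auto
          then show "\<epsilon> * h \<le> \<epsilon> * h * (1 + h * L) ^ Suc k" by simp
        qed (use h L in auto)
        also have "\<dots> = real (Suc k) * h * \<epsilon> * (1 + h * L) ^ Suc k" by (simp add: algebra_simps)
        finally show ?case unfolding b_def .
      qed
      have "norm (x n - X t) \<le> \<tau> t * \<epsilon> * (1 + h * L) ^ n"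
        using err[of n] h(2) Gt[of t] t by simp
      also have "\<dots> \<le> \<tau> t * \<epsilon> * exp (L * \<tau> t)"
      proof (rule mult_left_mono)
        have "(1 + h * L) ^ n \<le> exp (h * L) ^ n"
          using h L by (intro power_mono exp_ge_add_one_self) auto
        also have "\<dots> = exp (L * \<tau> t)" unfolding h(2)[symmetric] by (simp add: exp_of_nat_mult[symmetric] mult_ac)
        finally show "(1 + h * L) ^ n \<le> exp (L * \<tau> t)" .
      qed (use \<tau>t \<epsilon> in auto)
      also have "\<dots> = e / 2" using \<tau>t by (simp add: \<epsilon>_def)
      also have "\<dots> < e" using e by simp
      finally show "norm (euler \<nu> (\<tau> t / real n) n (X 0) - X t) < e" by (simp add: x_def h_def)
    qed
  qed
qed

end

text \<open>Discrete Gronwall inequality. The Lipschitz bound is used for \<open>\<nu>\<close> only,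
  so the defects are evaluated on the scheme of \<open>\<mu>\<close>; with \<open>\<nu>\<close> the
  empirical law, these points do not depend on the sample.\<close>

lemma euler_diff_le:
  assumes "bounded_law \<mu> K" "bounded_law \<nu> K" "0 \<le> h"
  shows "norm (euler \<mu> h k x - euler \<nu> h k x) \<le>
    (\<Sum>j<k. h * exp (K\<^sup>2 * ((real k * h)\<^sup>2 - (real j * h)\<^sup>2) / 2) *
       norm (tilt_mean \<mu> (real j * h) (euler \<mu> h j x) - tilt_mean \<nu> (real j * h) (euler \<mu> h j x)))"
proof (induction k)
  case (Suc k)
  define E where "E i j = exp (K\<^sup>2 * ((real i * h)\<^sup>2 - (real j * h)\<^sup>2) / 2)" for i j
  define \<delta> where "\<delta> j = norm (tilt_mean \<mu> (real j * h) (euler \<mu> h j x) - tilt_mean \<nu> (real j * h) (euler \<mu> h j x))" for j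
  let ?x = "euler \<mu> h k x" and ?z = "euler \<nu> h k x" and ?s = "real k * h"
  have "euler \<mu> h (Suc k) x - euler \<nu> h (Suc k) x = (?x - ?z)
      + h *\<^sub>R (tilt_mean \<nu> ?s ?x - tilt_mean \<nu> ?s ?z) + h *\<^sub>R (tilt_mean \<mu> ?s ?x - tilt_mean \<nu> ?s ?x)"
    by (simp add: algebra_simps)
  also have "norm \<dots> \<le> norm (?x - ?z) + h * (?s * K\<^sup>2 * norm (?x - ?z)) + h * \<delta> k"
    using \<open>0 \<le> h\<close> bounded_law.tilt_mean_lipschitz[OF assms(2), of ?s ?x ?z]
    by (intro order_trans[OF norm_triangle_ineq] add_mono) (auto simp: \<delta>_def intro!: mult_left_mono)
  also have "\<dots> = (1 + h * ?s * K\<^sup>2) * norm (?x - ?z) + h * \<delta> k" by (simp add: algebra_simps)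
  also have "\<dots> \<le> E (Suc k) k * (\<Sum>j<k. h * E k j * \<delta> j) + h * E (Suc k) k * \<delta> k"
  proof (intro add_mono mult_mono)
    have "1 + h * ?s * K\<^sup>2 \<le> exp (h * ?s * K\<^sup>2)" by (rule exp_ge_add_one_self)
    also have "\<dots> \<le> E (Suc k) k"
    proof -
      \<comment> \<open>The growth exponent is absorbed by 2 h s <= (s + h)^2 - s^2, so the factors
        \<open>E\<close> telescope exactly and the exponent keeps its sharp constant.\<close>
      have "h * ?s * K\<^sup>2 = K\<^sup>2 * (2 * h * ?s) / 2" by simp
      also have "\<dots> \<le> K\<^sup>2 * ((real (Suc k) * h)\<^sup>2 - ?s\<^sup>2) / 2"
        by (intro divide_right_mono mult_left_mono) (auto simp: power2_eq_square algebra_simps)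
      finally show ?thesis by (simp add: E_def)
    qed
    finally show "1 + h * ?s * K\<^sup>2 \<le> E (Suc k) k" .
    have "?s\<^sup>2 \<le> (real (Suc k) * h)\<^sup>2" using \<open>0 \<le> h\<close> by (intro power_mono mult_right_mono) auto
    then have "1 \<le> E (Suc k) k" by (simp add: E_def)
    then show "h \<le> h * E (Suc k) k" using \<open>0 \<le> h\<close> mult_left_mono[of 1 "E (Suc k) k" h] by simp
    show "norm (?x - ?z) \<le> (\<Sum>j<k. h * E k j * \<delta> j)" using Suc by (simp add: E_def \<delta>_def)
  qed (use \<open>0 \<le> h\<close> in \<open>auto simp: \<delta>_def E_def\<close>)
  also have "E (Suc k) k * (\<Sum>j<k. h * E k j * \<delta> j) = (\<Sum>j<k. h * E (Suc k) j * \<delta> j)"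
  proof -
    have "E (Suc k) k * E k j = E (Suc k) j" for j
      unfolding E_def exp_add[symmetric] by (simp add: field_simps)
    then show ?thesis by (simp add: sum_distrib_left mult_ac)
  qed
  finally show ?case by (simp add: E_def \<delta>_def)
qed simp

section \<open>Monte Carlo error of the empirical denoiser\<close>

text \<open>Pulling the multiset back to the uniform law on indices turns integrals into sums over
  \<open>j\<close>, where coinciding sample points keep their multiplicity.\<close>

lemma emp_measure_eq_map_pmf:
  assumes "1 \<le> N"
  shows "emp_measure c N = measure_pmf (map_pmf c (pmf_of_set {..<N}))"
proof -
  have "map_pmf c (pmf_of_set {..<N}) = pmf_of_multiset (image_mset c (mset_set {..<N}))"
  proof (rule pmf_eqI)
    fix x
    have "{..<N} \<noteq> {}" using assms by (simp add: lessThan_empty_iff)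
    moreover have "image_mset c (mset_set {..<N}) \<noteq> {#}" using assms by (auto simp: mset_set_empty_iff lessThan_empty_iff)
    ultimately show "pmf (map_pmf c (pmf_of_set {..<N})) x = pmf (pmf_of_multiset (image_mset c (mset_set {..<N}))) x"
      by (simp add: pmf_map measure_pmf_of_set count_image_mset Int_commute)
  qed
  then show ?thesis by (simp add: emp_measure_def)
qed

lemma integral_emp_measure:
  fixes f :: "'a \<Rightarrow> 'b::{banach, second_countable_topology}"
  assumes "1 \<le> N"
  shows "(\<integral>x. f x \<partial>emp_measure c N) = (\<Sum>j<N. f (c j)) /\<^sub>R real N"
proof -
  have "{..<N} \<noteq> {}" using assms by (simp add: lessThan_empty_iff)
  then show ?thesis unfolding emp_measure_eq_map_pmf[OF assms]
    by (subst integral_map_pmf, subst integral_measure_pmf[of "{..<N}"])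
       (auto simp: pmf_of_set scaleR_sum_right divide_inverse)
qed

lemma bounded_law_emp_measure:
  fixes c :: "nat \<Rightarrow> 'a::euclidean_space"
  assumes "1 \<le> N" "\<And>j. j < N \<Longrightarrow> norm (c j) \<le> K"
  shows "bounded_law (emp_measure c N) K"
proof -
  have "{..<N} \<noteq> {}" using assms by (simp add: lessThan_empty_iff)
  then have "AE y in emp_measure c N. norm y \<le> K"
    unfolding emp_measure_eq_map_pmf[OF assms(1)] using assms(2)
    by (auto simp: AE_measure_pmf_iff)
  then show ?thesis
    by (simp add: bounded_law_def bounded_law_axioms_def)
       (simp add: emp_measure_def measure_pmf.prob_space_axioms)
qed

lemma tilt_mean_emp_measure:
  assumes "1 \<le> N"
  shows "tilt_mean (emp_measure c N) s x =
    (\<Sum>j<N. tilt_weight s x (c j) *\<^sub>R c j) /\<^sub>R (\<Sum>j<N. tilt_weight s x (c j))"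
  using assms by (simp add: tilt_mean_def tilt_mass_def integral_emp_measure)

text \<open>Centred independent vectors are orthogonal in L^2, so only the diagonal of the double
  sum survives.\<close>

lemma (in prob_space) integral_norm_sum_sq:
  fixes \<zeta> :: "'i \<Rightarrow> 'a \<Rightarrow> 'b::euclidean_space"
  assumes fin: "finite I" and ind: "indep_vars (\<lambda>_. borel) \<zeta> I"
    and int: "\<And>i. i \<in> I \<Longrightarrow> integrable M (\<zeta> i)"
    and sq: "\<And>i. i \<in> I \<Longrightarrow> integrable M (\<lambda>\<omega>. (norm (\<zeta> i \<omega>))\<^sup>2)"
    and mean: "\<And>i. i \<in> I \<Longrightarrow> (\<integral>\<omega>. \<zeta> i \<omega> \<partial>M) = 0"
  shows "integrable M (\<lambda>\<omega>. (norm (\<Sum>i\<in>I. \<zeta> i \<omega>))\<^sup>2)"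
    and "(\<integral>\<omega>. (norm (\<Sum>i\<in>I. \<zeta> i \<omega>))\<^sup>2 \<partial>M) = (\<Sum>i\<in>I. \<integral>\<omega>. (norm (\<zeta> i \<omega>))\<^sup>2 \<partial>M)"
proof -
  have cross: "integrable M (\<lambda>\<omega>. \<zeta> i \<omega> \<bullet> \<zeta> j \<omega>) \<and> (\<integral>\<omega>. \<zeta> i \<omega> \<bullet> \<zeta> j \<omega> \<partial>M) = 0"
    if ij: "i \<in> I" "j \<in> I" "i \<noteq> j" for i j
  proof -
    \<comment> \<open>Independence factorises products of scalars, so the inner product is treated
      one basis direction at a time.\<close>
    have comp: "integrable M (\<lambda>\<omega>. (\<zeta> i \<omega> \<bullet> b) * (\<zeta> j \<omega> \<bullet> b)) \<and> (\<integral>\<omega>. (\<zeta> i \<omega> \<bullet> b) * (\<zeta> j \<omega> \<bullet> b) \<partial>M) = 0" for b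
    proof -
      have "indep_vars (\<lambda>_. borel) \<zeta> {i, j}" using ij by (intro indep_vars_subset[OF ind]) auto
      then have iv: "indep_vars (\<lambda>_. borel) (\<lambda>k \<omega>. \<zeta> k \<omega> \<bullet> b) {i, j}"
        by (rule indep_vars_compose2) auto
      have ii: "integrable M (\<lambda>\<omega>. \<zeta> k \<omega> \<bullet> b)" if "k \<in> {i, j}" for k using that ij int by auto
      have 1: "integrable M (\<lambda>\<omega>. \<Prod>k\<in>{i, j}. \<zeta> k \<omega> \<bullet> b)"
        by (rule indep_vars_integrable[OF _ iv ii]) auto
      have 2: "(\<integral>\<omega>. (\<Prod>k\<in>{i, j}. \<zeta> k \<omega> \<bullet> b) \<partial>M) = (\<Prod>k\<in>{i, j}. \<integral>\<omega>. \<zeta> k \<omega> \<bullet> b \<partial>M)"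
        by (rule indep_vars_lebesgue_integral[OF _ iv ii]) auto
      have "(\<integral>\<omega>. \<zeta> i \<omega> \<bullet> b \<partial>M) = 0" using int[OF ij(1)] mean[OF ij(1)] by simp
      then show ?thesis using 1 2 ij(3) by simp
    qed
    have "\<zeta> i \<omega> \<bullet> \<zeta> j \<omega> = (\<Sum>b\<in>Basis. (\<zeta> i \<omega> \<bullet> b) * (\<zeta> j \<omega> \<bullet> b))" for \<omega>
      by (rule euclidean_inner)
    then show ?thesis using comp by simp
  qed
  have all: "integrable M (\<lambda>\<omega>. \<zeta> i \<omega> \<bullet> \<zeta> j \<omega>)" if "i \<in> I" "j \<in> I" for i j
    using cross[of i j] sq[of i] that by (cases "i = j") (auto simp: power2_norm_eq_inner)
  have eq: "(norm (\<Sum>i\<in>I. \<zeta> i \<omega>))\<^sup>2 = (\<Sum>i\<in>I. \<Sum>j\<in>I. \<zeta> i \<omega> \<bullet> \<zeta> j \<omega>)" for \<omega>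
    by (simp add: power2_norm_eq_inner inner_sum_left inner_sum_right) (rule sum.swap)
  show "integrable M (\<lambda>\<omega>. (norm (\<Sum>i\<in>I. \<zeta> i \<omega>))\<^sup>2)"
    unfolding eq by (intro Bochner_Integration.integrable_sum all)
  have "(\<integral>\<omega>. (norm (\<Sum>i\<in>I. \<zeta> i \<omega>))\<^sup>2 \<partial>M) = (\<Sum>i\<in>I. \<Sum>j\<in>I. \<integral>\<omega>. \<zeta> i \<omega> \<bullet> \<zeta> j \<omega> \<partial>M)"
    unfolding eq using all by (simp add: Bochner_Integration.integral_sum)
  also have "\<dots> = (\<Sum>i\<in>I. \<Sum>j\<in>I. if i = j then \<integral>\<omega>. (norm (\<zeta> i \<omega>))\<^sup>2 \<partial>M else 0)"
    using cross by (intro sum.cong) (auto simp: power2_norm_eq_inner)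
  also have "\<dots> = (\<Sum>i\<in>I. \<integral>\<omega>. (norm (\<zeta> i \<omega>))\<^sup>2 \<partial>M)"
    using fin by simp
  finally show "(\<integral>\<omega>. (norm (\<Sum>i\<in>I. \<zeta> i \<omega>))\<^sup>2 \<partial>M) = (\<Sum>i\<in>I. \<integral>\<omega>. (norm (\<zeta> i \<omega>))\<^sup>2 \<partial>M)" .
qed

text \<open>Decoupling: the joint law is a product, so \<open>Y\<close> may be evaluated at a
  second, separately integrated outcome.\<close>

lemma (in prob_space) nn_integral_indep_var:
  assumes "indep_var S X T Y" and [measurable]: "case_prod H \<in> borel_measurable (S \<Otimes>\<^sub>M T)"
  shows "(\<integral>\<^sup>+\<omega>. H (X \<omega>) (Y \<omega>) \<partial>M) = (\<integral>\<^sup>+\<omega>. \<integral>\<^sup>+\<omega>'. H (X \<omega>) (Y \<omega>') \<partial>M \<partial>M)"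
proof -
  note d = assms(1)[unfolded indep_var_distribution_eq]
  have [measurable]: "X \<in> measurable M S" "Y \<in> measurable M T" using d by auto
  interpret T: prob_space "distr M T Y" by (rule prob_space_distr) measurable
  have "(\<integral>\<^sup>+\<omega>. H (X \<omega>) (Y \<omega>) \<partial>M) = (\<integral>\<^sup>+p. case_prod H p \<partial>distr M (S \<Otimes>\<^sub>M T) (\<lambda>\<omega>. (X \<omega>, Y \<omega>)))"
    by (subst nn_integral_distr) auto
  also have "\<dots> = (\<integral>\<^sup>+p. case_prod H p \<partial>(distr M S X \<Otimes>\<^sub>M distr M T Y))" using d by simp
  also have "\<dots> = (\<integral>\<^sup>+x. \<integral>\<^sup>+y. H x y \<partial>distr M T Y \<partial>distr M S X)"
    by (subst T.nn_integral_fst[symmetric]) auto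
  also have "\<dots> = (\<integral>\<^sup>+\<omega>. \<integral>\<^sup>+y. H (X \<omega>) y \<partial>distr M T Y \<partial>M)"
    by (rule nn_integral_distr) (auto intro!: T.borel_measurable_nn_integral)
  also have "\<dots> = (\<integral>\<^sup>+\<omega>. \<integral>\<^sup>+\<omega>'. H (X \<omega>) (Y \<omega>') \<partial>M \<partial>M)"
  proof (rule nn_integral_cong)
    fix \<omega> assume "\<omega> \<in> space M"
    then have "X \<omega> \<in> space S" using measurable_space[of X M S] by auto
    then have "H (X \<omega>) \<in> borel_measurable T" using measurable_Pair2[OF assms(2)] by simp
    then show "(\<integral>\<^sup>+y. H (X \<omega>) y \<partial>distr M T Y) = (\<integral>\<^sup>+\<omega>'. H (X \<omega>) (Y \<omega>') \<partial>M)"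
      by (subst nn_integral_distr) auto
  qed
  finally show ?thesis .
qed

section \<open>Averaged error of the empirical tilted mean\<close>

locale iid_sample = bounded_law \<mu> K + M: prob_space M
  for \<mu> :: "'a::euclidean_space measure" and K :: real and M :: "'w measure" +
  fixes \<eta> :: "nat \<Rightarrow> 'w \<Rightarrow> 'a"
  assumes indep: "M.indep_vars (\<lambda>_. borel) \<eta> UNIV"
    and law: "\<And>j. distr M borel (\<eta> j) = \<mu>"
begin

definition sample_error :: "nat \<Rightarrow> real \<Rightarrow> 'a \<Rightarrow> 'w \<Rightarrow> real" where
  "sample_error N s x \<omega> = norm (tilt_mean \<mu> s x - tilt_mean (emp_measure (\<lambda>j. \<eta> j \<omega>) N) s x)"

lemma \<eta>_measurable [measurable]: "\<eta> j \<in> borel_measurable M"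
  using indep by (simp add: M.indep_vars_def)

lemma AE_\<eta>_le: "AE \<omega> in M. \<forall>j. norm (\<eta> j \<omega>) \<le> K"
  unfolding AE_all_countable
proof
  fix j
  have "AE y in distr M borel (\<eta> j). norm y \<le> K" unfolding law by (rule AE_norm_le)
  then show "AE \<omega> in M. norm (\<eta> j \<omega>) \<le> K" by (subst (asm) AE_distr_iff) auto
qed

lemma sample_error_measurable:
  assumes [simp]: "1 \<le> N"
  shows "(\<lambda>(x, \<omega>). sample_error N s x \<omega>) \<in> borel_measurable (borel \<Otimes>\<^sub>M M)"
  unfolding sample_error_def tilt_mean_emp_measure[OF assms] split_beta' by measurable

lemma sample_error_measurable' [measurable (raw)]:
  assumes "1 \<le> N" "f \<in> borel_measurable M'" "g \<in> measurable M' M"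
  shows "(\<lambda>w. sample_error N s (f w) (g w)) \<in> borel_measurable M'"
  using measurable_compose[OF measurable_Pair[OF assms(2,3)] sample_error_measurable[OF assms(1)]] by simp

text \<open>Both tilted means have Lipschitz constant \<open>s * K\<^sup>2\<close>, which accounts
  for the 2. This makes the averaged error an admissible test function for the passage from Euler
  points to the exact law.\<close>

lemma sample_error_lipschitz:
  assumes N: "1 \<le> N" and "0 \<le> s"
  shows "(\<integral>\<^sup>+\<omega>. ennreal (sample_error N s z \<omega>) \<partial>M)
    \<le> (\<integral>\<^sup>+\<omega>. ennreal (sample_error N s x \<omega>) \<partial>M) + ennreal (2 * s * K\<^sup>2 * norm (x - z))"
proof -
  have "(\<integral>\<^sup>+\<omega>. ennreal (sample_error N s z \<omega>) \<partial>M)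
      \<le> (\<integral>\<^sup>+\<omega>. ennreal (sample_error N s x \<omega>) + ennreal (2 * s * K\<^sup>2 * norm (x - z)) \<partial>M)"
  proof (rule nn_integral_mono_AE)
    show "AE \<omega> in M. ennreal (sample_error N s z \<omega>)
        \<le> ennreal (sample_error N s x \<omega>) + ennreal (2 * s * K\<^sup>2 * norm (x - z))"
      using AE_\<eta>_le
    proof eventually_elim
      fix \<omega> assume "\<forall>j. norm (\<eta> j \<omega>) \<le> K"
      then interpret e: bounded_law "emp_measure (\<lambda>j. \<eta> j \<omega>) N" K
        using N by (intro bounded_law_emp_measure) auto
      let ?m = "tilt_mean \<mu> s" and ?e = "tilt_mean (emp_measure (\<lambda>j. \<eta> j \<omega>) N) s"
      have "norm (?m z - ?e z) \<le> norm (?m x - ?e x) + (norm (?m x - ?m z) + norm (?e x - ?e z))"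
        by norm
      also have "\<dots> \<le> norm (?m x - ?e x) + (s * K\<^sup>2 * norm (x - z) + s * K\<^sup>2 * norm (x - z))"
        using assms by (intro add_mono order_refl tilt_mean_lipschitz e.tilt_mean_lipschitz)
      finally show "ennreal (sample_error N s z \<omega>)
          \<le> ennreal (sample_error N s x \<omega>) + ennreal (2 * s * K\<^sup>2 * norm (x - z))"
        using \<open>0 \<le> s\<close> by (simp add: sample_error_def ennreal_plus[symmetric] ennreal_leI mult_ac del: ennreal_plus)
    qed
  qed
  also have "\<dots> = (\<integral>\<^sup>+\<omega>. ennreal (sample_error N s x \<omega>) \<partial>M) + ennreal (2 * s * K\<^sup>2 * norm (x - z))"
    using N by (subst nn_integral_add) (auto simp: M.emeasure_space_1)
  finally show ?thesis .
qed

lemma integrable_comp_\<eta>: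
  fixes f :: "'a \<Rightarrow> 'b::{banach, second_countable_topology}"
  assumes [measurable]: "f \<in> borel_measurable borel"
  shows "integrable M (\<lambda>\<omega>. f (\<eta> j \<omega>)) = integrable \<mu> f"
  by (subst law[of j, symmetric], subst integrable_distr_eq) auto

lemma integral_comp_\<eta>:
  fixes f :: "'a \<Rightarrow> 'b::{banach, second_countable_topology}"
  assumes [measurable]: "f \<in> borel_measurable borel"
  shows "(\<integral>\<omega>. f (\<eta> j \<omega>) \<partial>M) = (\<integral>y. f y \<partial>\<mu>)"
  by (subst law[of j, symmetric], subst integral_distr) auto

text \<open>The inequality 2 l d <= l^2 + d^2 replaces the root of the variance. With
  \<open>l\<close> left free, the bound is linear in the second moment and can still be integrated
  over the base point.\<close>

lemma sample_mean_error_le: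
  fixes f :: "'a \<Rightarrow> 'b::euclidean_space"
  assumes [measurable]: "f \<in> borel_measurable borel"
    and B: "\<And>y. norm y \<le> K \<Longrightarrow> norm (f y) \<le> B"
    and N: "1 \<le> N" and lam: "0 < l"
  shows "(\<integral>\<^sup>+\<omega>. ennreal (norm ((\<Sum>j<N. f (\<eta> j \<omega>)) /\<^sub>R real N - (\<integral>y. f y \<partial>\<mu>))) \<partial>M)
    \<le> ennreal ((l + (\<integral>y. (norm (f y))\<^sup>2 \<partial>\<mu>) / (real N * l)) / 2)"
proof -
  define m where "m = (\<integral>y. f y \<partial>\<mu>)"
  define S where "S \<omega> = (\<Sum>j<N. f (\<eta> j \<omega>) - m)" for \<omega>
  have fi: "integrable \<mu> f" by (rule integrable_if_bounded[OF assms(1) B])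
  have f2: "integrable \<mu> (\<lambda>y. (norm (f y))\<^sup>2)"
    by (rule integrable_if_bounded[of _ "B\<^sup>2"]) (auto intro!: power_mono B)
  have exp: "(norm (f y - m))\<^sup>2 = (norm (f y))\<^sup>2 - 2 * (f y \<bullet> m) + (norm m)\<^sup>2" for y
    unfolding power2_norm_eq_inner by (simp add: inner_diff_left inner_diff_right inner_commute)
  have fm2: "integrable \<mu> (\<lambda>y. (norm (f y - m))\<^sup>2)" unfolding exp using fi f2 by simp
  have var: "(\<integral>y. (norm (f y - m))\<^sup>2 \<partial>\<mu>) \<le> (\<integral>y. (norm (f y))\<^sup>2 \<partial>\<mu>)"
  proof -
    have "(\<integral>y. (norm (f y - m))\<^sup>2 \<partial>\<mu>) = (\<integral>y. (norm (f y))\<^sup>2 \<partial>\<mu>) - (norm m)\<^sup>2"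
      unfolding exp using fi f2 by (simp add: prob_space m_def[symmetric] power2_norm_eq_inner)
    then show ?thesis by simp
  qed
  have ind: "M.indep_vars (\<lambda>_. borel) (\<lambda>j \<omega>. f (\<eta> j \<omega>) - m) {..<N}"
    by (rule M.indep_vars_compose2[OF M.indep_vars_subset[OF indep]]) auto
  have c1: "integrable M (\<lambda>\<omega>. f (\<eta> j \<omega>) - m)" for j
    using integrable_comp_\<eta>[of f] fi by simp
  have c2: "integrable M (\<lambda>\<omega>. (norm (f (\<eta> j \<omega>) - m))\<^sup>2)" for j
    using integrable_comp_\<eta>[of "\<lambda>y. (norm (f y - m))\<^sup>2"] fm2 by simp
  have c3: "(\<integral>\<omega>. f (\<eta> j \<omega>) - m \<partial>M) = 0" for j
    using integrable_comp_\<eta>[of f] integral_comp_\<eta>[of f] fi by (simp add: M.prob_space m_def)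
  have S2: "integrable M (\<lambda>\<omega>. (norm (S \<omega>))\<^sup>2)"
    unfolding S_def by (rule M.integral_norm_sum_sq(1)[OF _ ind c1 c2 c3]) simp
  have "(\<integral>\<omega>. (norm (S \<omega>))\<^sup>2 \<partial>M) = (\<Sum>j<N. \<integral>\<omega>. (norm (f (\<eta> j \<omega>) - m))\<^sup>2 \<partial>M)"
    unfolding S_def by (rule M.integral_norm_sum_sq(2)[OF _ ind c1 c2 c3]) simp
  also have "\<dots> \<le> real N * (\<integral>y. (norm (f y))\<^sup>2 \<partial>\<mu>)"
    using var by (simp add: integral_comp_\<eta>[of "\<lambda>y. (norm (f y - m))\<^sup>2"] mult_left_mono)
  finally have ES: "(\<integral>\<omega>. (norm (S \<omega>))\<^sup>2 \<partial>M) \<le> real N * (\<integral>y. (norm (f y))\<^sup>2 \<partial>\<mu>)" .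
  have "(\<integral>\<^sup>+\<omega>. ennreal (norm ((\<Sum>j<N. f (\<eta> j \<omega>)) /\<^sub>R real N - m)) \<partial>M)
      \<le> (\<integral>\<^sup>+\<omega>. ennreal ((l + (norm (S \<omega>))\<^sup>2 / ((real N)\<^sup>2 * l)) / 2) \<partial>M)"
  proof (intro nn_integral_mono ennreal_leI)
    fix \<omega>
    have "(\<Sum>j<N. f (\<eta> j \<omega>)) /\<^sub>R real N - m = S \<omega> /\<^sub>R real N"
      using N by (simp add: S_def sum_subtractf scaleR_diff_right sum_constant_scaleR)
    then have eq: "norm ((\<Sum>j<N. f (\<eta> j \<omega>)) /\<^sub>R real N - m) = norm (S \<omega>) / real N"
      by (simp add: divide_inverse_commute)
    have "2 * l * (norm (S \<omega>) / real N) \<le> l\<^sup>2 + (norm (S \<omega>) / real N)\<^sup>2" by (rule sum_squares_bound)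
    then show "norm ((\<Sum>j<N. f (\<eta> j \<omega>)) /\<^sub>R real N - m) \<le> (l + (norm (S \<omega>))\<^sup>2 / ((real N)\<^sup>2 * l)) / 2"
      unfolding eq using lam N by (simp add: field_simps power2_eq_square)
  qed
  also have "\<dots> = ennreal (\<integral>\<omega>. (l + (norm (S \<omega>))\<^sup>2 / ((real N)\<^sup>2 * l)) / 2 \<partial>M)"
    using S2 lam by (intro nn_integral_eq_integral) auto
  also have "(\<integral>\<omega>. (l + (norm (S \<omega>))\<^sup>2 / ((real N)\<^sup>2 * l)) / 2 \<partial>M)
      = (l + (\<integral>\<omega>. (norm (S \<omega>))\<^sup>2 \<partial>M) / ((real N)\<^sup>2 * l)) / 2"
    using S2 by (simp add: M.prob_space)
  also have "\<dots> \<le> (l + (\<integral>y. (norm (f y))\<^sup>2 \<partial>\<mu>) / (real N * l)) / 2"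
  proof -
    have "(\<integral>\<omega>. (norm (S \<omega>))\<^sup>2 \<partial>M) / ((real N)\<^sup>2 * l) \<le> (real N * (\<integral>y. (norm (f y))\<^sup>2 \<partial>\<mu>)) / ((real N)\<^sup>2 * l)"
      using lam by (intro divide_right_mono[OF ES]) auto
    also have "\<dots> = (\<integral>y. (norm (f y))\<^sup>2 \<partial>\<mu>) / (real N * l)" using N by (simp add: power2_eq_square)
    finally show ?thesis by (intro divide_right_mono add_left_mono) auto
  qed
  finally show ?thesis by (simp add: m_def ennreal_leI)
qed

text \<open>Multiplication by the mass removes the random denominator. Two sample means remain, of
  the weights and of the weighted points; the latter have second moment at most
  \<open>K\<^sup>2\<close> times that of the weights.\<close>

lemma sample_error_mass_le:
  assumes N: "1 \<le> N" and c: "0 < c"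
  shows "ennreal (tilt_mass \<mu> s x) * (\<integral>\<^sup>+\<omega>. ennreal (sample_error N s x \<omega>) \<partial>M)
    \<le> ennreal (K / sqrt (real N) * (c + (\<integral>y. (tilt_weight s x y)\<^sup>2 \<partial>\<mu>) / c))"
proof (cases "K = 0")
  \<comment> \<open>For \<open>K = 0\<close> the parameter \<open>K * c / n\<close> used below would
    vanish; here both tilted means are 0.\<close>
  case True
  have "AE \<omega> in M. ennreal (sample_error N s x \<omega>) = 0" using AE_\<eta>_le
  proof eventually_elim
    fix \<omega> assume "\<forall>j. norm (\<eta> j \<omega>) \<le> K"
    then interpret e: bounded_law "emp_measure (\<lambda>j. \<eta> j \<omega>) N" K
      using N by (intro bounded_law_emp_measure) auto
    show "ennreal (sample_error N s x \<omega>) = 0"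
      using norm_tilt_mean_le[of s x] e.norm_tilt_mean_le[of s x] True by (simp add: sample_error_def)
  qed
  then have "(\<integral>\<^sup>+\<omega>. ennreal (sample_error N s x \<omega>) \<partial>M) = 0"
    using N by (subst nn_integral_0_iff_AE) auto
  then show ?thesis by simp
next
  case False
  then have K: "0 < K" using K_nonneg by simp
  define a where "a y = tilt_weight s x y *\<^sub>R y" for y
  define w where "w = tilt_weight s x"
  define p where "p = tilt_mass \<mu> s x"
  define q where "q = (\<integral>y. (w y)\<^sup>2 \<partial>\<mu>)"
  define W where "W = exp (\<bar>s\<bar> * norm x * K)"
  define n where "n = sqrt (real N)"
  have n: "0 < n" "real N = n * n" using N by (auto simp: n_def)
  have p: "0 < p" unfolding p_def by (rule tilt_mass_pos)
  have wW: "w y \<le> W" if "norm y \<le> K" for y unfolding w_def W_def by (rule tilt_weight_le[OF that])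
  have [measurable]: "w \<in> borel_measurable borel" "a \<in> borel_measurable borel"
    unfolding w_def a_def by measurable
  have w0: "0 < w y" for y by (simp add: w_def)
  have aW: "norm (a y) \<le> W * K" if "norm y \<le> K" for y
  proof -
    have "norm (a y) = w y * norm y" using w0[of y] by (simp add: a_def w_def)
    also have "\<dots> \<le> W * K" using wW[OF that] w0[of y] that by (intro mult_mono) auto
    finally show ?thesis .
  qed
  define A where "A \<omega> = norm ((\<Sum>j<N. a (\<eta> j \<omega>)) /\<^sub>R real N - (\<integral>y. a y \<partial>\<mu>))" for \<omega>
  define B where "B \<omega> = norm ((\<Sum>j<N. w (\<eta> j \<omega>)) /\<^sub>R real N - (\<integral>y. w y \<partial>\<mu>))" for \<omega>
  have [measurable]: "A \<in> borel_measurable M" "B \<in> borel_measurable M"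
    unfolding A_def B_def by measurable
  have "ennreal p * (\<integral>\<^sup>+\<omega>. ennreal (sample_error N s x \<omega>) \<partial>M)
      = (\<integral>\<^sup>+\<omega>. ennreal p * ennreal (sample_error N s x \<omega>) \<partial>M)"
    using N by (intro nn_integral_cmult[symmetric]) simp
  also have "\<dots> \<le> (\<integral>\<^sup>+\<omega>. ennreal (A \<omega>) + ennreal K * ennreal (B \<omega>) \<partial>M)"
  proof (rule nn_integral_mono_AE)
    show "AE \<omega> in M. ennreal p * ennreal (sample_error N s x \<omega>) \<le> ennreal (A \<omega>) + ennreal K * ennreal (B \<omega>)"
      using AE_\<eta>_le
    proof eventually_elim
      fix \<omega> assume "\<forall>j. norm (\<eta> j \<omega>) \<le> K"
      then interpret e: bounded_law "emp_measure (\<lambda>j. \<eta> j \<omega>) N" K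
        using N by (intro bounded_law_emp_measure) auto
      define AN where "AN = (\<Sum>j<N. a (\<eta> j \<omega>)) /\<^sub>R real N"
      define BN where "BN = (\<Sum>j<N. w (\<eta> j \<omega>)) /\<^sub>R real N"
      let ?m = "tilt_mean \<mu> s x" and ?e = "tilt_mean (emp_measure (\<lambda>j. \<eta> j \<omega>) N) s x"
      have BN: "tilt_mass (emp_measure (\<lambda>j. \<eta> j \<omega>) N) s x = BN"
        using N by (simp add: tilt_mass_def integral_emp_measure BN_def w_def)
      then have "0 < BN" using e.tilt_mass_pos by metis
      then have e: "BN *\<^sub>R ?e = AN"
        using N by (simp add: tilt_mean_def BN) (simp add: integral_emp_measure AN_def a_def)
      have m: "p *\<^sub>R ?m = (\<integral>y. a y \<partial>\<mu>)"
        using p by (simp add: tilt_mean_def p_def a_def)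
      \<comment> \<open>The identity that avoids dividing by \<open>BN\<close>: the denominator
        error only meets \<open>?e\<close>, whose norm is at most \<open>K\<close>.\<close>
      have "p *\<^sub>R (?e - ?m) = (AN - (\<integral>y. a y \<partial>\<mu>)) - (BN - p) *\<^sub>R ?e"
        unfolding e[symmetric] m[symmetric] by (simp add: algebra_simps)
      then have "norm (p *\<^sub>R (?e - ?m)) \<le> norm (AN - (\<integral>y. a y \<partial>\<mu>)) + norm ((BN - p) *\<^sub>R ?e)"
        by (simp only: norm_triangle_ineq4)
      also have "\<dots> \<le> A \<omega> + K * B \<omega>"
        using e.norm_tilt_mean_le[of s x]
        by (auto simp: A_def B_def AN_def BN_def p_def tilt_mass_def w_def mult.commute intro!: mult_right_mono)
      finally have "p * sample_error N s x \<omega> \<le> A \<omega> + K * B \<omega>"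
        using p by (simp add: sample_error_def norm_minus_commute)
      then show "ennreal p * ennreal (sample_error N s x \<omega>) \<le> ennreal (A \<omega>) + ennreal K * ennreal (B \<omega>)"
        using p K by (simp add: A_def B_def ennreal_mult[symmetric] ennreal_plus[symmetric] ennreal_leI
            sample_error_def del: ennreal_plus)
    qed
  qed
  also have "\<dots> = (\<integral>\<^sup>+\<omega>. ennreal (A \<omega>) \<partial>M) + ennreal K * (\<integral>\<^sup>+\<omega>. ennreal (B \<omega>) \<partial>M)"
    by (simp add: nn_integral_add nn_integral_cmult)
  also have "\<dots> \<le> ennreal (K / n * (c + q / c) / 2) + ennreal K * ennreal ((c + q / c) / n / 2)"
  \<comment> \<open>The free parameter is \<open>c / n\<close> for the weights and
    \<open>K * c / n\<close> for the weighted points, so that both contributions equal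
    \<open>K / n * (c + q / c) / 2\<close>.\<close>
  proof (intro add_mono mult_left_mono)
    have "(\<integral>\<^sup>+\<omega>. ennreal (B \<omega>) \<partial>M) \<le> ennreal ((c / n + (\<integral>y. (norm (w y))\<^sup>2 \<partial>\<mu>) / (real N * (c / n))) / 2)"
      unfolding B_def using n(1) c N wW w0
      by (intro sample_mean_error_le[where B = W]) (auto simp: less_imp_le)
    also have "(c / n + (\<integral>y. (norm (w y))\<^sup>2 \<partial>\<mu>) / (real N * (c / n))) / 2 = (c + q / c) / n / 2"
      using n c by (simp add: q_def field_simps)
    finally show "(\<integral>\<^sup>+\<omega>. ennreal (B \<omega>) \<partial>M) \<le> ennreal ((c + q / c) / n / 2)" .
    have "(\<integral>\<^sup>+\<omega>. ennreal (A \<omega>) \<partial>M) \<le> ennreal ((K * c / n + (\<integral>y. (norm (a y))\<^sup>2 \<partial>\<mu>) / (real N * (K * c / n))) / 2)"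
      unfolding A_def using n(1) c N K aW
      by (intro sample_mean_error_le[where B = "W * K"]) auto
    also have "\<dots> \<le> ennreal ((K * c / n + K\<^sup>2 * q / (real N * (K * c / n))) / 2)"
    proof (intro ennreal_leI divide_right_mono add_left_mono)
      have "(\<integral>y. (norm (a y))\<^sup>2 \<partial>\<mu>) \<le> (\<integral>y. K\<^sup>2 * (w y)\<^sup>2 \<partial>\<mu>)"
      proof (rule integral_mono_AE)
        show "integrable \<mu> (\<lambda>y. (norm (a y))\<^sup>2)" 
          by (intro integrable_if_bounded[of _ "(W * K)\<^sup>2"]) (auto intro!: power_mono aW)
        show "integrable \<mu> (\<lambda>y. K\<^sup>2 * (w y)\<^sup>2)" using wW w0
          by (intro integrable_mult_right integrable_if_bounded[of _ "W\<^sup>2"]) (auto intro!: power_mono simp: less_imp_le)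
        show "AE y in \<mu>. (norm (a y))\<^sup>2 \<le> K\<^sup>2 * (w y)\<^sup>2" using AE_norm_le
          by eventually_elim
             (auto simp: a_def w_def[symmetric] power_mult_distrib mult.commute intro!: mult_right_mono power_mono)
      qed
      then show "(\<integral>y. (norm (a y))\<^sup>2 \<partial>\<mu>) \<le> K\<^sup>2 * q" by (simp add: q_def)
    qed (use K c n in auto)
    also have "(K * c / n + K\<^sup>2 * q / (real N * (K * c / n))) / 2 = K / n * (c + q / c) / 2"
      using n c K by (simp add: field_simps power2_eq_square)
    finally show "(\<integral>\<^sup>+\<omega>. ennreal (A \<omega>) \<partial>M) \<le> ennreal (K / n * (c + q / c) / 2)" .
  qed auto
  also have "\<dots> = ennreal (K / n * (c + q / c))"
  proof -
    have "0 \<le> q" by (simp add: q_def)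
    then show ?thesis using K n c
      by (simp add: ennreal_mult[symmetric] ennreal_plus[symmetric] del: ennreal_plus)
  qed
  finally show ?thesis by (simp add: p_def n_def q_def w_def)
qed

text \<open>After squaring, the weight at clock \<open>2 * s\<close> merely shifts the Gaussian,
  whose mass stays 1; only \<open>exp (s\<^sup>2 * (norm y)\<^sup>2)\<close> is left.\<close>

lemma nn_integral_tilt_weight_sq_le:
  assumes prob: "prob_space (density lborel (rho 1 :: 'a \<Rightarrow> real))"
  shows "(\<integral>\<^sup>+x. ennreal (rho 1 x * (\<integral>y. (tilt_weight s x y)\<^sup>2 \<partial>\<mu>)) \<partial>lborel) \<le> ennreal (exp (s\<^sup>2 * K\<^sup>2))"
proof -
  interpret pair_sigma_finite lborel \<mu> ..
  have one: "(\<integral>\<^sup>+x. ennreal (rho 1 (x - a)) \<partial>lborel) = 1" for a :: 'a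
  proof -
    have "(\<integral>\<^sup>+x. ennreal (rho 1 (x - a)) \<partial>lborel) = (\<integral>\<^sup>+x. ennreal (rho 1 (x :: 'a)) \<partial>lborel)"
      using nn_integral_lborel_shift[of "\<lambda>x. ennreal (rho 1 x)" "- a"] by simp
    also have "\<dots> = 1" using prob_space.emeasure_space_1[OF prob] by (simp add: emeasure_density)
    finally show ?thesis .
  qed
  have "(\<integral>\<^sup>+x. ennreal (rho 1 x * (\<integral>y. (tilt_weight s x y)\<^sup>2 \<partial>\<mu>)) \<partial>lborel)
      = (\<integral>\<^sup>+x. \<integral>\<^sup>+y. ennreal (exp (s\<^sup>2 * (norm y)\<^sup>2)) * ennreal (rho 1 (x - (2 * s) *\<^sub>R y)) \<partial>\<mu> \<partial>lborel)"
  proof (rule nn_integral_cong)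
    fix x :: 'a
    have i: "integrable \<mu> (\<lambda>y. (tilt_weight s x y)\<^sup>2)"
      by (rule integrable_if_bounded[of _ "(exp (\<bar>s\<bar> * norm x * K))\<^sup>2"]) (auto intro!: power_mono tilt_weight_le)
    have "ennreal (rho 1 x * (\<integral>y. (tilt_weight s x y)\<^sup>2 \<partial>\<mu>)) = ennreal (\<integral>y. rho 1 x * (tilt_weight s x y)\<^sup>2 \<partial>\<mu>)"
      by simp
    also have "\<dots> = (\<integral>\<^sup>+y. ennreal (rho 1 x * (tilt_weight s x y)\<^sup>2) \<partial>\<mu>)"
      using i by (intro nn_integral_eq_integral[symmetric]) auto
    also have "\<dots> = (\<integral>\<^sup>+y. ennreal (exp (s\<^sup>2 * (norm y)\<^sup>2)) * ennreal (rho 1 (x - (2 * s) *\<^sub>R y)) \<partial>\<mu>)"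
      by (simp add: tilt_weight_sq rho_mult_tilt_weight[symmetric] ennreal_mult[symmetric] mult_ac)
    finally show "ennreal (rho 1 x * (\<integral>y. (tilt_weight s x y)\<^sup>2 \<partial>\<mu>)) = \<dots>" .
  qed
  also have "\<dots> = (\<integral>\<^sup>+y. \<integral>\<^sup>+x. ennreal (exp (s\<^sup>2 * (norm y)\<^sup>2)) * ennreal (rho 1 (x - (2 * s) *\<^sub>R y)) \<partial>lborel \<partial>\<mu>)"
    by (rule Fubini'[symmetric]) measurable
  also have "\<dots> = (\<integral>\<^sup>+y. ennreal (exp (s\<^sup>2 * (norm y)\<^sup>2)) \<partial>\<mu>)"
    by (simp add: nn_integral_cmult one)
  also have "\<dots> \<le> (\<integral>\<^sup>+y. ennreal (exp (s\<^sup>2 * K\<^sup>2)) \<partial>\<mu>)"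
    using AE_norm_le by (intro nn_integral_mono_AE) (auto intro!: ennreal_leI mult_left_mono power_mono)
  also have "\<dots> = ennreal (exp (s\<^sup>2 * K\<^sup>2))" by (simp add: emeasure_space_1)
  finally show ?thesis .
qed

text \<open>The parameter \<open>c\<close> is the root of the bound
  \<open>exp (s\<^sup>2 * K\<^sup>2)\<close> on the averaged second moment. Being independent of
  \<open>x\<close>, it can be taken out of the integral, and
  \<open>c + c\<^sup>2 / c = 2 * c\<close>.\<close>

lemma nn_integral_sample_error_le:
  assumes N: "1 \<le> N" and prob: "prob_space (density lborel (rho 1 :: 'a \<Rightarrow> real))"
  shows "(\<integral>\<^sup>+x. ennreal (rho 1 x * tilt_mass \<mu> s x) * (\<integral>\<^sup>+\<omega>. ennreal (sample_error N s x \<omega>) \<partial>M) \<partial>lborel)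
    \<le> ennreal (2 * K / sqrt (real N) * exp (K\<^sup>2 * s\<^sup>2 / 2))"
proof -
  define c where "c = exp (K\<^sup>2 * s\<^sup>2 / 2)"
  define q where "q x = (\<integral>y. (tilt_weight s x y)\<^sup>2 \<partial>\<mu>)" for x
  have c: "0 < c" by (simp add: c_def)
  have cc: "exp (s\<^sup>2 * K\<^sup>2) = c * c" by (simp add: c_def exp_add[symmetric] mult.commute)
  have q: "0 \<le> q x" for x by (simp add: q_def)
  have [measurable]: "q \<in> borel_measurable borel" unfolding q_def[abs_def] by measurable
  have "(\<integral>\<^sup>+x. ennreal (rho 1 x * tilt_mass \<mu> s x) * (\<integral>\<^sup>+\<omega>. ennreal (sample_error N s x \<omega>) \<partial>M) \<partial>lborel)
      \<le> (\<integral>\<^sup>+x. ennreal (K / sqrt (real N)) * (ennreal c * ennreal (rho 1 x) + ennreal (1 / c) * ennreal (rho 1 x * q x)) \<partial>lborel)"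
  proof (rule nn_integral_mono)
    fix x :: 'a
    have "ennreal (rho 1 x * tilt_mass \<mu> s x) * (\<integral>\<^sup>+\<omega>. ennreal (sample_error N s x \<omega>) \<partial>M)
        = ennreal (rho 1 x) * (ennreal (tilt_mass \<mu> s x) * (\<integral>\<^sup>+\<omega>. ennreal (sample_error N s x \<omega>) \<partial>M))"
      using tilt_mass_pos[of s x] by (simp add: ennreal_mult mult.assoc less_imp_le)
    also have "\<dots> \<le> ennreal (rho 1 x) * ennreal (K / sqrt (real N) * (c + q x / c))"
      unfolding q_def by (intro mult_left_mono sample_error_mass_le N c) auto
    also have "\<dots> = ennreal (K / sqrt (real N)) * (ennreal c * ennreal (rho 1 x) + ennreal (1 / c) * ennreal (rho 1 x * q x))"
      using c K_nonneg q[of x]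
      by (simp add: ennreal_mult[symmetric] ennreal_plus[symmetric] del: ennreal_plus) (simp add: field_simps)
    finally show "ennreal (rho 1 x * tilt_mass \<mu> s x) * (\<integral>\<^sup>+\<omega>. ennreal (sample_error N s x \<omega>) \<partial>M) \<le> \<dots>" .
  qed
  also have "\<dots> = ennreal (K / sqrt (real N)) * (ennreal c * (\<integral>\<^sup>+x. ennreal (rho 1 (x::'a)) \<partial>lborel)
      + ennreal (1 / c) * (\<integral>\<^sup>+x. ennreal (rho 1 x * q x) \<partial>lborel))"
    by (simp add: nn_integral_cmult nn_integral_add)
  also have "\<dots> \<le> ennreal (K / sqrt (real N)) * (ennreal c * 1 + ennreal (1 / c) * ennreal (c * c))"
  proof (intro mult_left_mono add_mono)
    show "(\<integral>\<^sup>+x. ennreal (rho 1 (x::'a)) \<partial>lborel) \<le> 1"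
      using prob_space.emeasure_space_1[OF prob] by (simp add: emeasure_density)
    show "(\<integral>\<^sup>+x. ennreal (rho 1 x * q x) \<partial>lborel) \<le> ennreal (c * c)"
      using nn_integral_tilt_weight_sq_le[OF prob, of s] by (simp add: q_def cc)
  qed auto
  also have "\<dots> = ennreal (2 * K / sqrt (real N) * c)"
    using c K_nonneg by (simp add: ennreal_mult[symmetric] ennreal_plus[symmetric] del: ennreal_plus)
  finally show ?thesis by (simp add: c_def)
qed

end

section \<open>Comparison of the two flows\<close>

text \<open>Serves to extract the sample from the joint family indexed by \<open>nat option\<close>.
  Events are transported to the image index set, where injectivity keeps the products equal.\<close>

lemma (in prob_space) indep_vars_reindex:
  assumes inj: "inj_on f I" and ind: "indep_vars M' X (f ` I)"
  shows "indep_vars (\<lambda>i. M' (f i)) (\<lambda>i. X (f i)) I"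
  unfolding indep_vars_def2
proof (intro conjI ballI indep_setsI)
  fix i assume "i \<in> I"
  then show "random_variable (M' (f i)) (X (f i))" using ind by (simp add: indep_vars_def2)
  then show "{X (f i) -` A \<inter> space M | A. A \<in> sets (M' (f i))} \<subseteq> events" by auto
next
  fix A J
  assume J: "J \<noteq> {}" "J \<subseteq> I" "finite J" "\<forall>j\<in>J. A j \<in> {X (f j) -` A \<inter> space M | A. A \<in> sets (M' (f j))}"
  define B where "B k = A (the_inv_into J f k)" for k
  have injJ: "inj_on f J" using inj J(2) by (rule inj_on_subset)
  have B: "B (f j) = A j" if "j \<in> J" for j unfolding B_def by (simp add: the_inv_into_f_f[OF injJ that])
  have "prob (\<Inter>k\<in>f ` J. B k) = (\<Prod>k\<in>f ` J. prob (B k))"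
    using J B ind unfolding indep_vars_def2
    by (intro indep_setsD[where I = "f ` I" and F = "\<lambda>i. {X i -` A \<inter> space M | A. A \<in> sets (M' i)}"]) auto
  then show "prob (\<Inter>j\<in>J. A j) = (\<Prod>j\<in>J. prob (A j))"
    using B by (simp add: prod.reindex[OF injJ])
qed

lemma (in iid_sample) nn_integral_sample_error_indep:
  assumes N: "1 \<le> N" and [measurable]: "g \<in> borel_measurable borel"
    and ind: "M.indep_vars (\<lambda>_. borel) (\<lambda>i. case i of None \<Rightarrow> Y0 | Some j \<Rightarrow> \<eta> j) UNIV"
  shows "(\<integral>\<^sup>+\<omega>. ennreal (sample_error N s (g (Y0 \<omega>)) \<omega>) \<partial>M)
    = (\<integral>\<^sup>+\<omega>. \<integral>\<^sup>+\<omega>'. ennreal (sample_error N s (g (Y0 \<omega>)) \<omega>') \<partial>M \<partial>M)"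
proof -
  define X where "X i = (case i of None \<Rightarrow> Y0 | Some j \<Rightarrow> \<eta> j)" for i
  define B where "B = Some ` {..<N}"
  define H :: "(nat option \<Rightarrow> 'a) \<Rightarrow> (nat option \<Rightarrow> 'a) \<Rightarrow> ennreal" where
    "H a c = ennreal (norm (tilt_mean \<mu> s (g (a None)) -
      (\<Sum>j<N. tilt_weight s (g (a None)) (c (Some j)) *\<^sub>R c (Some j))
        /\<^sub>R (\<Sum>j<N. tilt_weight s (g (a None)) (c (Some j)))))" for a c
  have iv: "M.indep_var (PiM {None} (\<lambda>_. borel)) (\<lambda>\<omega>. restrict (\<lambda>i. X i \<omega>) {None})
      (PiM B (\<lambda>_. borel)) (\<lambda>\<omega>. restrict (\<lambda>i. X i \<omega>) B)"
    using ind by (intro M.indep_var_restrict[where I = UNIV]) (auto simp: X_def[abs_def] B_def)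
  have [measurable]: "(\<lambda>p. snd p (Some j)) \<in> borel_measurable (PiM {None} (\<lambda>_. borel) \<Otimes>\<^sub>M PiM B (\<lambda>_. borel :: 'a measure))"
    if "j \<in> {..<N}" for j
    using that by (intro measurable_compose[OF measurable_snd] measurable_component_singleton) (auto simp: B_def)
  have [measurable]: "(\<lambda>p. fst p None) \<in> borel_measurable (PiM {None} (\<lambda>_. borel :: 'a measure) \<Otimes>\<^sub>M PiM B (\<lambda>_. borel :: 'a measure))"
    by (intro measurable_compose[OF measurable_fst] measurable_component_singleton) auto
  have "case_prod H \<in> borel_measurable (PiM {None} (\<lambda>_. borel) \<Otimes>\<^sub>M PiM B (\<lambda>_. borel))"
    unfolding H_def split_beta' by measurable
  from M.nn_integral_indep_var[OF iv this]
  have "(\<integral>\<^sup>+\<omega>. H (restrict (\<lambda>i. X i \<omega>) {None}) (restrict (\<lambda>i. X i \<omega>) B) \<partial>M)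
      = (\<integral>\<^sup>+\<omega>. \<integral>\<^sup>+\<omega>'. H (restrict (\<lambda>i. X i \<omega>) {None}) (restrict (\<lambda>i. X i \<omega>') B) \<partial>M \<partial>M)" .
  moreover have "H (restrict (\<lambda>i. X i \<omega>) {None}) (restrict (\<lambda>i. X i \<omega>') B) = ennreal (sample_error N s (g (Y0 \<omega>)) \<omega>')" for \<omega> \<omega>'
    by (simp add: H_def X_def B_def sample_error_def tilt_mean_emp_measure[OF N])
  ultimately show ?thesis by simp
qed

section \<open>Error along the Euler scheme from a Gaussian start, and its limit\<close>

locale gaussian_start = iid_sample \<mu> K M \<eta>
  for \<mu> :: "'a::euclidean_space measure" and K :: real and M :: "'w measure" and \<eta> +
  fixes Y0 :: "'w \<Rightarrow> 'a"
  assumes indep_Y0: "M.indep_vars (\<lambda>_. borel) (\<lambda>i. case i of None \<Rightarrow> Y0 | Some j \<Rightarrow> \<eta> j) UNIV"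
    and Y0_law: "distr M borel Y0 = density lborel (rho 1)"
begin

lemma Y0_measurable [measurable]: "Y0 \<in> borel_measurable M"
  using indep_Y0 unfolding M.indep_vars_def by (metis UNIV_I option.simps(4))

lemma prob_space_gaussian: "prob_space (density lborel (rho 1 :: 'a \<Rightarrow> real))"
  unfolding Y0_law[symmetric] by (rule M.prob_space_distr) measurable

text \<open>The Euler point depends on \<open>Y0\<close> only, so decoupling replaces the error by
  its sample average \<open>F\<close>. The start is Gaussian, and \<open>F\<close> can be integrated
  against the exact law up to an error of order \<open>sqrt h\<close>.\<close>

lemma nn_integral_euler_sample_error_le:
  assumes N: "1 \<le> N" and h: "0 < h" and k: "real k * h \<le> \<tau>"
  shows "(\<integral>\<^sup>+\<omega>. ennreal (sample_error N (real k * h) (euler \<mu> h k (Y0 \<omega>)) \<omega>) \<partial>M)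
    \<le> ennreal (2 * K / sqrt (real N) * exp (K\<^sup>2 * (real k * h)\<^sup>2 / 2)
        + 2 * \<tau> * K\<^sup>2 * (1 + \<tau> * K\<^sup>2 * exp (2 * \<tau>\<^sup>2 * K\<^sup>2)) * sqrt h)"
proof -
  define s where "s = real k * h"
  define F where "F x = (\<integral>\<^sup>+\<omega>. ennreal (sample_error N s x \<omega>) \<partial>M)" for x
  have s: "0 \<le> s" "s \<le> \<tau>" using h k by (auto simp: s_def)
  have [measurable]: "F \<in> borel_measurable borel"
    using N unfolding F_def[abs_def] by (intro M.borel_measurable_nn_integral) (simp add: split_beta')
  have "(\<integral>\<^sup>+\<omega>. ennreal (sample_error N s (euler \<mu> h k (Y0 \<omega>)) \<omega>) \<partial>M) = (\<integral>\<^sup>+\<omega>. F (euler \<mu> h k (Y0 \<omega>)) \<partial>M)"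
    unfolding F_def by (rule nn_integral_sample_error_indep[OF N euler_measurable indep_Y0])
  also have "\<dots> = (\<integral>\<^sup>+z. F (euler \<mu> h k z) \<partial>density lborel (rho 1))"
    unfolding Y0_law[symmetric] by (subst nn_integral_distr) auto
  also have "\<dots> \<le> (\<integral>\<^sup>+x. ennreal (rho 1 x * tilt_mass \<mu> (real k * h) x) * F x \<partial>lborel)
      + ennreal (2 * \<tau> * K\<^sup>2 * (1 + \<tau> * K\<^sup>2 * exp (2 * \<tau>\<^sup>2 * K\<^sup>2)) * sqrt h)"
  proof (rule nn_integral_euler_le[OF _ _ _ h k prob_space_gaussian])
    show "F z \<le> F x + ennreal (2 * \<tau> * K\<^sup>2 * norm (x - z))" for x z
      unfolding F_def
      by (rule order_trans[OF sample_error_lipschitz[OF N s(1), of z x]])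
         (use s in \<open>auto intro!: add_left_mono ennreal_leI mult_right_mono\<close>)
  qed (use s in auto)
  also have "\<dots> \<le> ennreal (2 * K / sqrt (real N) * exp (K\<^sup>2 * s\<^sup>2 / 2))
      + ennreal (2 * \<tau> * K\<^sup>2 * (1 + \<tau> * K\<^sup>2 * exp (2 * \<tau>\<^sup>2 * K\<^sup>2)) * sqrt h)"
    unfolding F_def s_def[symmetric]
    by (intro add_right_mono nn_integral_sample_error_le N prob_space_gaussian)
  also have "\<dots> = ennreal (2 * K / sqrt (real N) * exp (K\<^sup>2 * s\<^sup>2 / 2)
      + 2 * \<tau> * K\<^sup>2 * (1 + \<tau> * K\<^sup>2 * exp (2 * \<tau>\<^sup>2 * K\<^sup>2)) * sqrt h)"
    using K_nonneg s h by (intro ennreal_plus[symmetric]) auto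
  finally show ?thesis unfolding s_def .
qed

text \<open>Fatou's lemma passes from the Euler schemes to their limits. The factor \<open>a\<close>
  stays inside the integral because \<open>Z\<close> and \<open>ZN\<close> are not assumed
  measurable; the estimate is made by monotonicity against a measurable majorant.\<close>

lemma nn_integral_euler_limit_le:
  assumes N: "1 \<le> N" and \<tau>: "0 < \<tau>"
    and Z: "\<And>\<omega>. \<omega> \<in> space M \<Longrightarrow> (\<lambda>n. euler \<mu> (\<tau> / real n) n (Y0 \<omega>)) \<longlonglongrightarrow> Z \<omega>"
    and ZN: "\<And>\<omega>. \<omega> \<in> space M \<Longrightarrow> \<forall>j. norm (\<eta> j \<omega>) \<le> K \<Longrightarrow>
      (\<lambda>n. euler (emp_measure (\<lambda>j. \<eta> j \<omega>) N) (\<tau> / real n) n (Y0 \<omega>)) \<longlonglongrightarrow> ZN \<omega>"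
  shows "(\<integral>\<^sup>+\<omega>. a * ennreal (norm (Z \<omega> - ZN \<omega>)) \<partial>M)
    \<le> a * ennreal (2 * K / sqrt (real N) * \<tau> * exp (K\<^sup>2 * \<tau>\<^sup>2 / 2))"
proof -
  define h where "h n = \<tau> / real n" for n :: nat
  define E where "E n j = exp (K\<^sup>2 * (\<tau>\<^sup>2 - (real j * h n)\<^sup>2) / 2)" for n j
  define S where "S n \<omega> = (\<Sum>j<n. h n * E n j *
      sample_error N (real j * h n) (euler \<mu> (h n) j (Y0 \<omega>)) \<omega>)" for n \<omega>
  define C where "C = 2 * \<tau> * K\<^sup>2 * (1 + \<tau> * K\<^sup>2 * exp (2 * \<tau>\<^sup>2 * K\<^sup>2))"
  define b where "b n = \<tau> * exp (K\<^sup>2 * \<tau>\<^sup>2 / 2) * (2 * K / sqrt (real N) + C * sqrt (h n))" for n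
  have C: "0 \<le> C" using \<tau> by (simp add: C_def)
  have h: "0 < h n" "real n * h n = \<tau>" if "1 \<le> n" for n using that \<tau> by (auto simp: h_def)
  have h0: "0 \<le> h n" for n using \<tau> by (simp add: h_def)
  have [measurable]: "S n \<in> borel_measurable M" for n unfolding S_def using N by measurable
  have "AE \<omega> in M. ennreal (norm (Z \<omega> - ZN \<omega>)) \<le> liminf (\<lambda>n. ennreal (S n \<omega>))"
    using AE_\<eta>_le AE_space
  proof eventually_elim
    fix \<omega> assume \<omega>: "\<forall>j. norm (\<eta> j \<omega>) \<le> K" "\<omega> \<in> space M"
    let ?\<nu> = "emp_measure (\<lambda>j. \<eta> j \<omega>) N"
    have \<nu>: "bounded_law ?\<nu> K" using N \<omega> by (intro bounded_law_emp_measure) auto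
    define d where "d n = norm (euler \<mu> (h n) n (Y0 \<omega>) - euler ?\<nu> (h n) n (Y0 \<omega>))" for n
    have "(\<lambda>n. ennreal (d n)) \<longlonglongrightarrow> ennreal (norm (Z \<omega> - ZN \<omega>))"
      unfolding d_def h_def by (intro tendsto_intros tendsto_ennrealI Z ZN \<omega>)
    then have "ennreal (norm (Z \<omega> - ZN \<omega>)) = liminf (\<lambda>n. ennreal (d n))"
      by (rule lim_imp_Liminf[OF trivial_limit_sequentially, symmetric])
    also have "\<dots> \<le> liminf (\<lambda>n. ennreal (S n \<omega>))"
    proof (intro Liminf_mono eventually_sequentiallyI ennreal_leI)
      fix n :: nat assume n: "1 \<le> n"
      show "d n \<le> S n \<omega>"
        using euler_diff_le[OF bounded_law_axioms \<nu> h0, of n n "Y0 \<omega>"]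
        unfolding d_def S_def E_def sample_error_def h(2)[OF n] .
    qed
    finally show "ennreal (norm (Z \<omega> - ZN \<omega>)) \<le> liminf (\<lambda>n. ennreal (S n \<omega>))" .
  qed
  then have "(\<integral>\<^sup>+\<omega>. a * ennreal (norm (Z \<omega> - ZN \<omega>)) \<partial>M) \<le> (\<integral>\<^sup>+\<omega>. a * liminf (\<lambda>n. ennreal (S n \<omega>)) \<partial>M)"
    by (intro nn_integral_mono_AE) (auto elim!: eventually_mono intro: mult_left_mono)
  also have "\<dots> = a * (\<integral>\<^sup>+\<omega>. liminf (\<lambda>n. ennreal (S n \<omega>)) \<partial>M)"
    by (rule nn_integral_cmult) measurable
  finally have le: "(\<integral>\<^sup>+\<omega>. a * ennreal (norm (Z \<omega> - ZN \<omega>)) \<partial>M) \<le> a * (\<integral>\<^sup>+\<omega>. liminf (\<lambda>n. ennreal (S n \<omega>)) \<partial>M)" .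
  have "(\<integral>\<^sup>+\<omega>. liminf (\<lambda>n. ennreal (S n \<omega>)) \<partial>M) \<le> liminf (\<lambda>n. \<integral>\<^sup>+\<omega>. ennreal (S n \<omega>) \<partial>M)"
    by (rule nn_integral_liminf) measurable
  also have "\<dots> \<le> liminf (\<lambda>n. ennreal (b n))"
  proof (intro Liminf_mono eventually_sequentiallyI)
    fix n :: nat assume n: "1 \<le> n"
    have "(\<integral>\<^sup>+\<omega>. ennreal (S n \<omega>) \<partial>M)
        = (\<integral>\<^sup>+\<omega>. (\<Sum>j<n. ennreal (h n * E n j) * ennreal (sample_error N (real j * h n) (euler \<mu> (h n) j (Y0 \<omega>)) \<omega>)) \<partial>M)"
      using h0 by (intro nn_integral_cong)
        (simp add: S_def E_def sample_error_def ennreal_mult[symmetric] sum_ennreal)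
    also have "\<dots> = (\<Sum>j<n. ennreal (h n * E n j) * (\<integral>\<^sup>+\<omega>. ennreal (sample_error N (real j * h n) (euler \<mu> (h n) j (Y0 \<omega>)) \<omega>) \<partial>M))"
      using N by (simp add: nn_integral_sum nn_integral_cmult)
    also have "\<dots> \<le> (\<Sum>j<n. ennreal (h n * (exp (K\<^sup>2 * \<tau>\<^sup>2 / 2) * (2 * K / sqrt (real N) + C * sqrt (h n)))))"
    proof (rule sum_mono)
      fix j assume j: "j \<in> {..<n}"
      then have jh: "real j * h n \<le> \<tau>" using h[OF n] by (metis h0 less_imp_le lessThan_iff mult_right_mono of_nat_le_iff)
      define D where "D = 2 * K / sqrt (real N) * exp (K\<^sup>2 * (real j * h n)\<^sup>2 / 2) + C * sqrt (h n)"
      have D: "0 \<le> D" using K_nonneg C h0[of n] by (simp add: D_def)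
      have "ennreal (h n * E n j) * (\<integral>\<^sup>+\<omega>. ennreal (sample_error N (real j * h n) (euler \<mu> (h n) j (Y0 \<omega>)) \<omega>) \<partial>M)
          \<le> ennreal (h n * E n j) * ennreal D"
        using nn_integral_euler_sample_error_le[OF N h(1)[OF n] jh]
        unfolding D_def C_def by (intro mult_left_mono) auto
      also have "\<dots> = ennreal (h n * (E n j * D))"
        using h0[of n] D by (simp add: ennreal_mult[symmetric] E_def mult.assoc)
      also have "\<dots> \<le> ennreal (h n * (exp (K\<^sup>2 * \<tau>\<^sup>2 / 2) * (2 * K / sqrt (real N) + C * sqrt (h n))))"
      proof (intro ennreal_leI mult_left_mono h0)
        \<comment> \<open>Gronwall and Monte Carlo exponents add up to a value independent of
          \<open>j\<close>, so the sum over \<open>j\<close> is just \<open>n\<close> times the step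
          size, which is \<open>\<tau>\<close>.\<close>
        have e: "E n j * exp (K\<^sup>2 * (real j * h n)\<^sup>2 / 2) = exp (K\<^sup>2 * \<tau>\<^sup>2 / 2)"
          unfolding E_def exp_add[symmetric] by (simp add: field_simps)
        have "E n j \<le> exp (K\<^sup>2 * \<tau>\<^sup>2 / 2)"
          by (simp add: E_def divide_right_mono mult_left_mono)
        then have "E n j * (C * sqrt (h n)) \<le> exp (K\<^sup>2 * \<tau>\<^sup>2 / 2) * (C * sqrt (h n))"
          using C h0[of n] by (intro mult_right_mono) auto
        moreover have "E n j * D = 2 * K / sqrt (real N) * (E n j * exp (K\<^sup>2 * (real j * h n)\<^sup>2 / 2)) + E n j * (C * sqrt (h n))"
          by (simp add: D_def algebra_simps)
        ultimately show "E n j * D \<le> exp (K\<^sup>2 * \<tau>\<^sup>2 / 2) * (2 * K / sqrt (real N) + C * sqrt (h n))"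
          unfolding e by (simp add: algebra_simps)
      qed
      finally show "ennreal (h n * E n j) * (\<integral>\<^sup>+\<omega>. ennreal (sample_error N (real j * h n) (euler \<mu> (h n) j (Y0 \<omega>)) \<omega>) \<partial>M) \<le> \<dots>" .
    qed
    also have "\<dots> = ennreal (real n * (h n * (exp (K\<^sup>2 * \<tau>\<^sup>2 / 2) * (2 * K / sqrt (real N) + C * sqrt (h n)))))"
      using h0[of n] K_nonneg C by (subst sum_ennreal) auto
    also have "real n * (h n * (exp (K\<^sup>2 * \<tau>\<^sup>2 / 2) * (2 * K / sqrt (real N) + C * sqrt (h n)))) = b n"
      unfolding b_def h(2)[OF n, symmetric] by (simp add: mult_ac)
    finally show "(\<integral>\<^sup>+\<omega>. ennreal (S n \<omega>) \<partial>M) \<le> ennreal (b n)" .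
  qed
  also have "\<dots> = ennreal (2 * K / sqrt (real N) * \<tau> * exp (K\<^sup>2 * \<tau>\<^sup>2 / 2))"
  proof (rule lim_imp_Liminf[OF trivial_limit_sequentially])
    have "h \<longlonglongrightarrow> 0" unfolding h_def by (rule lim_const_over_n)
    then have "b \<longlonglongrightarrow> \<tau> * exp (K\<^sup>2 * \<tau>\<^sup>2 / 2) * (2 * K / sqrt (real N) + C * sqrt 0)"
      unfolding b_def by (intro tendsto_intros)
    then show "(\<lambda>n. ennreal (b n)) \<longlonglongrightarrow> ennreal (2 * K / sqrt (real N) * \<tau> * exp (K\<^sup>2 * \<tau>\<^sup>2 / 2))"
      by (intro tendsto_ennrealI) (simp add: mult_ac)
  qed
  finally have "(\<integral>\<^sup>+\<omega>. liminf (\<lambda>n. ennreal (S n \<omega>)) \<partial>M)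
      \<le> ennreal (2 * K / sqrt (real N) * \<tau> * exp (K\<^sup>2 * \<tau>\<^sup>2 / 2))" .
  from order_trans[OF le mult_left_mono[OF this]] show ?thesis by simp
qed

end

text \<open>In \<open>X = y / \<sigma>\<close> the linear part of the drift cancels the derivative
  of \<open>1 / \<sigma>\<close>. What remains is the denoiser times
  \<open>- \<sigma>' / \<sigma>\<^sup>2\<close>, and this factor is the derivative of the
  clock.\<close>

lemma (in bounded_law) euler_converges_to_flow:
  assumes \<sigma>_cont: "continuous_on (tdom T) \<sigma>"
    and \<sigma>_pos: "\<And>s. s \<in> tdom T \<Longrightarrow> 0 < \<sigma> s"
    and \<sigma>_decr: "\<And>s u. s \<in> tdom T \<Longrightarrow> u \<in> tdom T \<Longrightarrow> s < u \<Longrightarrow> \<sigma> u < \<sigma> s"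
    and \<sigma>_deriv: "\<And>s. s \<in> tdom T \<Longrightarrow> (\<sigma> has_real_derivative \<sigma>' s) (at s within tdom T)"
    and \<sigma>_0: "\<sigma> 0 = 1"
    and ode: "\<And>s. s \<in> tdom T \<Longrightarrow> (y has_vector_derivative drift \<sigma> \<sigma>' \<nu> s (y s)) (at s within tdom T)"
    and t: "t \<in> tdom T" "0 < t"
  shows "(\<lambda>n. euler \<nu> ((1 - \<sigma> t) / \<sigma> t / real n) n (y 0)) \<longlonglongrightarrow> y t /\<^sub>R \<sigma> t"
proof -
  have sub: "{0..t} \<subseteq> tdom T"
    using t(1) unfolding tdom_def by (auto intro: le_less_trans[of "ereal _" "ereal t"])
  define \<tau> where "\<tau> r = (1 - \<sigma> r) / \<sigma> r" for r
  define X where "X r = y r /\<^sub>R \<sigma> r" for r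
  define \<tau>' where "\<tau>' r = - \<sigma>' r / (\<sigma> r)\<^sup>2" for r
  have pos: "0 < \<sigma> r" if "r \<in> {0..t}" for r using that sub \<sigma>_pos by auto
  then have nonzero: "\<forall>r\<in>{0..t}. \<sigma> r \<noteq> 0" by (metis less_irrefl)
  have y_cont: "continuous_on {0..t} y"
    using continuous_on_vector_derivative[OF ode] sub by (rule continuous_on_subset)
  have s_cont: "continuous_on {0..t} \<sigma>" using \<sigma>_cont sub by (rule continuous_on_subset)
  have at: "at r within tdom T = at r" if "0 < r" "r < t" for r
    using that sub by (intro at_within_open_subset[of r "{0<..<t}"]) auto
  have sd: "(\<sigma> has_real_derivative \<sigma>' r) (at r)" if "0 < r" "r < t" for r
    using \<sigma>_deriv[of r] at[OF that] that sub by (metis atLeastAtMost_iff less_imp_le subsetD)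
  have yd: "(y has_vector_derivative drift \<sigma> \<sigma>' \<nu> r (y r)) (at r)" if "0 < r" "r < t" for r
    using ode[of r] at[OF that] that sub by (metis atLeastAtMost_iff less_imp_le subsetD)
  have "(\<lambda>n. euler \<nu> (\<tau> t / real n) n (X 0)) \<longlonglongrightarrow> X t"
  proof (rule euler_converges[where \<tau>' = \<tau>'])
    show "continuous_on {0..t} \<tau>" "continuous_on {0..t} X"
      unfolding \<tau>_def X_def using nonzero s_cont y_cont by (auto intro!: continuous_intros)
    show "\<tau> r < \<tau> u" if "0 \<le> r" "r < u" "u \<le> t" for r u
    proof -
      have "\<sigma> u < \<sigma> r" using that sub by (intro \<sigma>_decr) auto
      then show ?thesis using pos[of r] pos[of u] that by (simp add: \<tau>_def field_simps)
    qed
    fix r assume r: "0 < r" "r < t"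
    have s0: "0 < \<sigma> r" using pos r by simp
    show "(\<tau> has_vector_derivative \<tau>' r) (at r)"
      unfolding \<tau>_def[abs_def] \<tau>'_def has_real_derivative_iff_has_vector_derivative[symmetric] using sd[OF r] s0
      by (auto intro!: derivative_eq_intros simp: field_simps power2_eq_square)
    \<comment> \<open>The sign of \<open>\<sigma>'\<close> follows from monotonicity: a positive
      derivative would make \<sigma> increase just after \<open>r\<close>. The increment is capped
      by \<open>t - r\<close> to stay inside the interval.\<close>
    show "0 \<le> \<tau>' r"
    proof (rule ccontr)
      assume "\<not> 0 \<le> \<tau>' r"
      then have "0 < \<sigma>' r" using s0 by (simp add: \<tau>'_def not_le zero_less_divide_iff)
      then obtain d where d: "0 < d" "\<And>e. 0 < e \<Longrightarrow> e < d \<Longrightarrow> \<sigma> r < \<sigma> (r + e)"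
        using DERIV_pos_inc_right[OF sd[OF r]] by blast
      define e where "e = min (d / 2) (t - r)"
      have e: "0 < e" "e < d" "r + e \<le> t" using d(1) r by (auto simp: e_def)
      have "\<sigma> (r + e) < \<sigma> r" using e r sub by (intro \<sigma>_decr) auto
      with d(2)[OF e(1,2)] show False by simp
    qed
    have "(X has_vector_derivative (inverse (\<sigma> r) *\<^sub>R drift \<sigma> \<sigma>' \<nu> r (y r)
        + (- (inverse (\<sigma> r) * \<sigma>' r * inverse (\<sigma> r))) *\<^sub>R y r)) (at r)"
      unfolding X_def using s0
      by (intro has_vector_derivative_scaleR yd[OF r] DERIV_inverse' sd[OF r]) auto
    moreover have "inverse (\<sigma> r) *\<^sub>R drift \<sigma> \<sigma>' \<nu> r (y r) + (- (inverse (\<sigma> r) * \<sigma>' r * inverse (\<sigma> r))) *\<^sub>R y r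
        = \<tau>' r *\<^sub>R tilt_mean \<nu> (\<tau> r) (X r)"
      unfolding drift_def denoiser_eq_tilt_mean[where \<sigma> = \<sigma> and t = r, OF s0] X_def[symmetric] \<tau>_def[symmetric] \<tau>'_def
      by (simp add: scaleR_diff_right divide_inverse power2_eq_square mult_ac)
    ultimately show "(X has_vector_derivative \<tau>' r *\<^sub>R tilt_mean \<nu> (\<tau> r) (X r)) (at r)" by simp
  qed (use t \<sigma>_0 in \<open>auto simp: \<tau>_def\<close>)
  then show ?thesis by (simp add: \<tau>_def X_def \<sigma>_0)
qed

theorem theorem3p2:
  fixes T :: ereal
    and \<sigma> \<sigma>' :: "real \<Rightarrow> real"
    and K :: real
    and \<mu>0 :: "'a::euclidean_space measure"
    and M :: "'w measure"
    and \<eta> :: "nat \<Rightarrow> 'w \<Rightarrow> 'a"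
    and Y0 :: "'w \<Rightarrow> 'a"
    and Y :: "'w \<Rightarrow> real \<Rightarrow> 'a"
    and YN :: "nat \<Rightarrow> 'w \<Rightarrow> real \<Rightarrow> 'a"
    and t :: real
  assumes T_pos: "0 < T"
    and \<sigma>_cont: "continuous_on (tdom T) \<sigma>"
    and \<sigma>_pos: "\<And>s. s \<in> tdom T \<Longrightarrow> 0 < \<sigma> s"
    and \<sigma>_decr: "\<And>s u. s \<in> tdom T \<Longrightarrow> u \<in> tdom T \<Longrightarrow> s < u \<Longrightarrow> \<sigma> u < \<sigma> s"
    and \<sigma>_deriv: "\<And>s. s \<in> tdom T \<Longrightarrow> (\<sigma> has_real_derivative \<sigma>' s) (at s within tdom T)"
    and \<sigma>'_bdd: "\<And>t0. t0 \<in> tdom T \<Longrightarrow> \<exists>C. \<forall>s\<in>{0..t0}. \<bar>\<sigma>' s\<bar> \<le> C"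
    and \<sigma>_0: "\<sigma> 0 = 1"
    and \<sigma>_lim: "if T = \<infinity> then (\<sigma> \<longlongrightarrow> 0) at_top
                 else (\<sigma> \<longlongrightarrow> 0) (at_left (real_of_ereal T))"
    and \<mu>0_prob: "prob_space \<mu>0"
    and \<mu>0_sets: "sets \<mu>0 = sets borel"
    and \<mu>0_supp: "AE x in \<mu>0. norm x \<le> K"
    and M_prob: "prob_space M"
    and indep: "prob_space.indep_vars M (\<lambda>_. borel)
                  (\<lambda>i. case i of None \<Rightarrow> Y0 | Some j \<Rightarrow> \<eta> j) UNIV"
    and \<eta>_law: "\<And>j. distr M borel (\<eta> j) = \<mu>0"
    and Y0_law: "distr M borel Y0 = density lborel (rho 1)"
    and Y_ode: "\<And>\<omega> s. \<omega> \<in> space M \<Longrightarrow> s \<in> tdom T \<Longrightarrow>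
                  (Y \<omega> has_vector_derivative drift \<sigma> \<sigma>' \<mu>0 s (Y \<omega> s)) (at s within tdom T)"
    and Y_init: "\<And>\<omega>. \<omega> \<in> space M \<Longrightarrow> Y \<omega> 0 = Y0 \<omega>"
    and YN_ode: "\<And>N \<omega> s. N \<ge> 1 \<Longrightarrow> \<omega> \<in> space M \<Longrightarrow> s \<in> tdom T \<Longrightarrow>
                  (YN N \<omega> has_vector_derivative
                     drift \<sigma> \<sigma>' (emp_measure (\<lambda>j. \<eta> j \<omega>) N) s (YN N \<omega> s)) (at s within tdom T)"
    and YN_init: "\<And>N \<omega>. N \<ge> 1 \<Longrightarrow> \<omega> \<in> space M \<Longrightarrow> YN N \<omega> 0 = Y0 \<omega>"
    and t_in: "t \<in> tdom T"
  shows "(SUP N\<in>{1::nat..}. ennreal (sqrt (real N)) * (\<integral>\<^sup>+ \<omega>. ennreal (norm (Y \<omega> t - YN N \<omega> t)) \<partial>M))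
           \<le> ennreal (2 * K * (1 - \<sigma> t) * exp (K\<^sup>2 * (1 - \<sigma> t)\<^sup>2 / (2 * (\<sigma> t)\<^sup>2)))"
proof (rule SUP_least)
  fix N :: nat assume "N \<in> {1..}"
  then have N: "1 \<le> N" by simp
  have K_law: "bounded_law \<mu>0 K"
    unfolding bounded_law_def bounded_law_axioms_def
    using \<mu>0_prob \<mu>0_supp by (simp add: measurable_ident_sets[OF \<mu>0_sets, unfolded id_def])
  interpret M: prob_space M by (rule M_prob)
  have "M.indep_vars (\<lambda>_. borel) (\<lambda>j. case Some j of None \<Rightarrow> Y0 | Some j \<Rightarrow> \<eta> j) UNIV"
    by (rule M.indep_vars_reindex[of Some UNIV, OF _ M.indep_vars_subset[OF indep]]) auto
  then interpret gaussian_start \<mu>0 K M \<eta> Y0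
    using K_law M_prob \<eta>_law indep Y0_law
    by (simp add: gaussian_start_def iid_sample_def iid_sample_axioms_def gaussian_start_axioms_def)
  define \<tau> where "\<tau> = (1 - \<sigma> t) / \<sigma> t"
  have st: "0 < \<sigma> t" using \<sigma>_pos t_in by simp
  show "ennreal (sqrt (real N)) * (\<integral>\<^sup>+ \<omega>. ennreal (norm (Y \<omega> t - YN N \<omega> t)) \<partial>M)
      \<le> ennreal (2 * K * (1 - \<sigma> t) * exp (K\<^sup>2 * (1 - \<sigma> t)\<^sup>2 / (2 * (\<sigma> t)\<^sup>2)))"
  \<comment> \<open>At time 0 the clock vanishes, whereas the limit argument needs a positive step;
    the two flows coincide there.\<close>
  proof (cases "t = 0")
    case True
    have "(\<integral>\<^sup>+ \<omega>. ennreal (norm (Y \<omega> t - YN N \<omega> t)) \<partial>M) = (\<integral>\<^sup>+ \<omega>. 0 \<partial>M)"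
      using Y_init YN_init[OF N] True by (intro nn_integral_cong) simp
    then show ?thesis by simp
  next
    case False
    then have t: "0 < t" using t_in by (simp add: tdom_def)
    have "0 \<in> tdom T" using T_pos by (simp add: tdom_def zero_ereal_def)
    then have "\<sigma> t < 1" using \<sigma>_decr[OF _ t_in t] \<sigma>_0 by simp
    then have \<tau>: "0 < \<tau>" using st by (simp add: \<tau>_def)
    note flow = bounded_law.euler_converges_to_flow[OF _ \<sigma>_cont \<sigma>_pos \<sigma>_decr \<sigma>_deriv \<sigma>_0 _ t_in t]
    have le: "(\<integral>\<^sup>+ \<omega>. ennreal (\<sigma> t) * ennreal (norm (Y \<omega> t /\<^sub>R \<sigma> t - YN N \<omega> t /\<^sub>R \<sigma> t)) \<partial>M)
        \<le> ennreal (\<sigma> t) * ennreal (2 * K / sqrt (real N) * \<tau> * exp (K\<^sup>2 * \<tau>\<^sup>2 / 2))"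
    proof (rule nn_integral_euler_limit_le[OF N \<tau>])
      fix \<omega> assume \<omega>: "\<omega> \<in> space M"
      show "(\<lambda>n. euler \<mu>0 (\<tau> / real n) n (Y0 \<omega>)) \<longlonglongrightarrow> Y \<omega> t /\<^sub>R \<sigma> t"
        using flow[OF K_law, of "Y \<omega>"] Y_ode[OF \<omega>] Y_init[OF \<omega>] by (simp add: \<tau>_def)
      assume "\<forall>j. norm (\<eta> j \<omega>) \<le> K"
      then have "bounded_law (emp_measure (\<lambda>j. \<eta> j \<omega>) N) K"
        using N by (intro bounded_law_emp_measure) auto
      from flow[OF this, of "YN N \<omega>"] YN_ode[OF N \<omega>] YN_init[OF N \<omega>]
      show "(\<lambda>n. euler (emp_measure (\<lambda>j. \<eta> j \<omega>) N) (\<tau> / real n) n (Y0 \<omega>)) \<longlonglongrightarrow> YN N \<omega> t /\<^sub>R \<sigma> t"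
        by (simp add: \<tau>_def)
    qed
    have "ennreal (norm (Y \<omega> t - YN N \<omega> t))
        = ennreal (\<sigma> t) * ennreal (norm (Y \<omega> t /\<^sub>R \<sigma> t - YN N \<omega> t /\<^sub>R \<sigma> t))" for \<omega>
    proof -
      have "norm (Y \<omega> t - YN N \<omega> t) = \<sigma> t * norm (Y \<omega> t /\<^sub>R \<sigma> t - YN N \<omega> t /\<^sub>R \<sigma> t)"
        using st by (simp flip: scaleR_diff_right)
      then show ?thesis using st by (simp add: ennreal_mult)
    qed
    then have "ennreal (sqrt (real N)) * (\<integral>\<^sup>+ \<omega>. ennreal (norm (Y \<omega> t - YN N \<omega> t)) \<partial>M)
        \<le> ennreal (sqrt (real N)) * (ennreal (\<sigma> t) * ennreal (2 * K / sqrt (real N) * \<tau> * exp (K\<^sup>2 * \<tau>\<^sup>2 / 2)))"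
      using mult_left_mono[OF le, of "ennreal (sqrt (real N))"] by simp
    also have "\<dots> = ennreal (sqrt (real N) * (\<sigma> t * (2 * K / sqrt (real N) * \<tau> * exp (K\<^sup>2 * \<tau>\<^sup>2 / 2))))"
      using st \<tau> K_nonneg by (simp add: ennreal_mult[symmetric])
    \<comment> \<open>The root of \<open>N\<close> cancels and
      \<open>\<sigma> t * \<tau> = 1 - \<sigma> t\<close>; squaring \<open>\<tau>\<close> gives the
      stated exponent.\<close>
    also have "sqrt (real N) * (\<sigma> t * (2 * K / sqrt (real N) * \<tau> * exp (K\<^sup>2 * \<tau>\<^sup>2 / 2)))
        = 2 * K * (1 - \<sigma> t) * exp (K\<^sup>2 * (1 - \<sigma> t)\<^sup>2 / (2 * (\<sigma> t)\<^sup>2))"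
      using st N by (simp add: \<tau>_def power_divide field_simps)
    finally show ?thesis .
  qed
qed

end
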